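(* For $n\ge2$, the restriction of the meromorphic function $T(t_1,\ldots,t_n)$ to the hypersurface $t_1\cdots t_n=1$ vanishes identically.
   Context: Fix $q$, $0<|q|<1$. With $(a)_\infty=\prod_{j\ge0}(1-aq^j)$, $\Theta(x)=(q)_\infty^{-2}(x^{1/2}-x^{-1/2})(qx)_\infty(q/x)_\infty$ and $\Theta^{(k)}=(x\frac d{dx})^k\Theta$. Define $$T(t_1,\ldots,t_n)=\sum_{\sigma\in\mathfrak S(n)}\frac{\det\Big(\frac{\Theta^{(j-i+1)}(t_{\sigma(1)}\cdots t_{\sigma(n-j)})}{(j-i+1)!}\Big)_{i,j=1}^n}{\Theta(t_{\sigma(1)})\Theta(t_{\sigma(1)}t_{\sigma(2)})\cdots\Theta(t_{\sigma(1)}\cdots t_{\sigma(n-1)})},$$ where empty products equal $1$, $1/(-k)!:=0$ for $k\ge1$, and square roots of products are products of chosen square roots $t_i^{1/2}$. (Equivalently $T=\Theta(t_1\cdots t_n)\,U(t_1,\ldots,t_n)$ with $U$ the same sum with the extra factor $\Theta(t_{\sigma(1)}\cdots t_{\sigma(n)})$ in the denominator.) *)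

theory Defs
  imports "HOL-Analysis.Analysis" "Jordan_Normal_Form.Determinant"
begin

definition qpoch :: "complex \<Rightarrow> complex \<Rightarrow> complex" where
  "qpoch q a = (\<Prod>j. 1 - a * q ^ j)"

text \<open>Theta, written as a function of the chosen square root s = x^(1/2), x = s^2:
  Theta(x) = (q)_\<infinity>^(-2) (s - 1/s) (q x)_\<infinity> (q/x)_\<infinity>.\<close>
definition theta :: "complex \<Rightarrow> complex \<Rightarrow> complex" where
  "theta q s = (s - 1 / s) * qpoch q (q * s\<^sup>2) * qpoch q (q / s\<^sup>2) / (qpoch q q)\<^sup>2"

text \<open>Theta^(k) = (x d/dx)^k Theta; in the variable s (x = s^2) one has x d/dx = (s/2) d/ds.\<close>
primrec thetaD :: "complex \<Rightarrow> nat \<Rightarrow> complex \<Rightarrow> complex" where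
  "thetaD q 0 = theta q"
| "thetaD q (Suc k) = (\<lambda>s. s / 2 * deriv (thetaD q k) s)"

definition pprod :: "(nat \<Rightarrow> complex) \<Rightarrow> (nat \<Rightarrow> nat) \<Rightarrow> nat \<Rightarrow> complex" where
  "pprod s \<sigma> m = (\<Prod>k<m. s (\<sigma> k))"

text \<open>The n x n matrix (0-based i,j), entry Theta^(j-i+1)(t_sigma(1)...t_sigma(n-j')) / (j-i+1)!
  with j' = j+1, and 0 when j-i+1 < 0.\<close>
definition Tmat :: "complex \<Rightarrow> nat \<Rightarrow> (nat \<Rightarrow> complex) \<Rightarrow> (nat \<Rightarrow> nat) \<Rightarrow> complex mat" where
  "Tmat q n s \<sigma> = mat n n (\<lambda>(i, j).
      if i \<le> j + 1 then thetaD q (j + 1 - i) (pprod s \<sigma> (n - (j + 1))) / of_nat (fact (j + 1 - i))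
      else 0)"

definition Tfun :: "complex \<Rightarrow> nat \<Rightarrow> (nat \<Rightarrow> complex) \<Rightarrow> complex" where
  "Tfun q n s = (\<Sum>\<sigma> | \<sigma> permutes {..<n}.
      det (Tmat q n s \<sigma>) / (\<Prod>m\<in>{1..<n}. theta q (pprod s \<sigma> m)))"

end

theory Submission
  imports Defs "HOL-Complex_Analysis.Complex_Analysis" "HOL-Combinatorics.Multiset_Permutations"
    "HOL-Library.Nat_Bijection" "HOL-Library.Periodic_Fun"
begin

unbundle no vec_syntax
no_notation fps_nth (infixl "$" 75)

text \<open>
  Write \<open>t\<^sub>i = exp (u\<^sub>i)\<close>, \<open>h(u) = \<Theta>(exp u)\<close>, \<open>E\<^sub>k = (-1)\<^sup>k h\<^sup>(\<^sup>k\<^sup>)\<close> and \<open>u\<^sub>B = \<Sum>\<^sub>i\<^sub>\<in>\<^sub>B u\<^sub>i\<close>. The matrix is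
  Hessenberg, so its determinant obeys a recursion along the prefixes of the permutation; after
  summing over all permutations the factorials cancel and \<open>T(S) = h(u\<^sub>S) F(S)\<close>, where \<open>F(\<emptyset>) = 1\<close>
  and \<open>\<Sum>\<^sub>B\<^sub>\<subseteq>\<^sub>S E\<^bsub>|S - B|\<^esub>(u\<^sub>B) F(B) = 0\<close> for nonempty \<open>S\<close>.

  Fix one variable \<open>x\<close>. By quasi-periodicity, replacing \<open>x\<close> with \<open>x + \<tau>\<close> sums the recursion over all
  subsets, and Moebius inversion gives \<open>T(x + \<tau>, S) = \<Sum>\<^sub>A\<^sub>\<subseteq>\<^sub>S (-1)\<^bsup>|A|\<^esup> T(x + u\<^sub>A, S - A)\<close>, whose
  right-hand side merges variables. By induction on the number of variables \<open>T\<close> vanishes on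
  \<open>u\<^sub>S = 0\<close> and is 1 on \<open>u\<^sub>S = -\<tau>\<close> for fewer variables, hence \<open>z \<mapsto> T(z, d - z, u\<^sub>3, \<dots>, u\<^sub>n)\<close> with
  \<open>d = -u\<^sub>3 - \<dots> - u\<^sub>n\<close> is elliptic. For generic \<open>u\<^sub>3, \<dots>, u\<^sub>n\<close> its possible poles are at \<open>-u\<^sub>B\<close> modulo
  the lattice. They are removable: for \<open>B\<close> nonempty and proper by the induction hypothesis, and at
  \<open>z = 0\<close> and \<open>z = d\<close> because \<open>T(z, S) = T(S)/z + h'(u\<^sub>S) F(S) + o(1)\<close>, which, \<open>h\<close> being odd, tends to
  0 on the hyperplane. By Liouville the function is 0; the nongeneric case follows by continuity.
\<close>

section \<open>Sums over subsets\<close>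

lemma finite_proper_subsets [simp]: "finite S \<Longrightarrow> finite {B. B \<subset> S}"
  by (rule finite_subset[of _ "Pow S"]) auto

lemma sum_Pow_proper:
  assumes "finite S"
  shows "(\<Sum>B\<in>Pow S. f B) = f S + (\<Sum>B | B \<subset> S. f B)"
proof -
  have "Pow S = insert S {B. B \<subset> S}" by auto
  then show ?thesis using assms by simp
qed

lemma sum_Pow_insert:
  assumes "finite S" "a \<notin> S"
  shows "(\<Sum>B\<in>Pow (insert a S). f B) = (\<Sum>B\<in>Pow S. f B) + (\<Sum>B\<in>Pow S. f (insert a B))"
proof -
  have "inj_on (insert a) (Pow S)" using assms(2) by (auto simp: inj_on_def)
  moreover have "Pow S \<inter> insert a ` Pow S = {}" using assms(2) by auto
  ultimately show ?thesis
    using assms(1) by (simp add: Pow_insert sum.union_disjoint sum.reindex o_def)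
qed

lemma sum_proper_insert:
  fixes f :: "'a set \<Rightarrow> 'b :: ab_group_add"
  assumes "finite S" "a \<notin> S"
  shows "(\<Sum>B | B \<subset> insert a S. f B) = (\<Sum>B\<in>Pow S. f B) + (\<Sum>B | B \<subset> S. f (insert a B))"
  using sum_Pow_insert[OF assms, of f] assms(1)
    sum_Pow_proper[of "insert a S" f] sum_Pow_proper[of S "\<lambda>B. f (insert a B)"]
  by (simp add: algebra_simps)

lemma sum_Pow_Pow_diff:
  assumes "finite S"
  shows "(\<Sum>B\<in>Pow S. \<Sum>A\<in>Pow B. f A (B - A)) = (\<Sum>A\<in>Pow S. \<Sum>Y\<in>Pow (S - A). f A Y)"
proof -
  have fin: "finite B" if "B \<subseteq> S" for B using assms that by (rule rev_finite_subset)
  have "(\<Sum>B\<in>Pow S. \<Sum>A\<in>Pow B. f A (B - A)) = (\<Sum>(B, A)\<in>Sigma (Pow S) Pow. f A (B - A))"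
    using assms fin by (subst sum.Sigma) auto
  also have "\<dots> = (\<Sum>(A, Y)\<in>Sigma (Pow S) (\<lambda>A. Pow (S - A)). f A Y)"
    by (rule sum.reindex_bij_witness[where i = "\<lambda>(A, Y). (A \<union> Y, A)" and j = "\<lambda>(B, A). (A, B - A)"])
       auto
  also have "\<dots> = (\<Sum>A\<in>Pow S. \<Sum>Y\<in>Pow (S - A). f A Y)"
    using assms by (subst sum.Sigma) auto
  finally show ?thesis .
qed

lemma sum_Pow_minus_one_power_card:
  assumes "finite S" "S \<noteq> {}"
  shows "(\<Sum>A\<in>Pow S. (-1) ^ card A) = (0 :: 'a :: ring_1)"
  using card_subsupersets_even_odd[of S "{}"] assms by (intro sum_alternating_cancels) auto

lemma moebius_inversion_Pow:
  fixes f :: "'a set \<Rightarrow> 'b :: ring_1"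
  assumes "finite S" "\<And>D. D \<subseteq> S \<Longrightarrow> g D = (\<Sum>B\<in>Pow D. f B)"
  shows "f S = (\<Sum>A\<in>Pow S. (-1) ^ card A * g (S - A))"
proof -
  have "f S = (\<Sum>D\<in>Pow S. (-1) ^ (card S - card D) * (\<Sum>B\<in>Pow D. f B))"
    using assms(1) by (rule inclusion_exclusion_mobius[rotated]) simp
  also have "\<dots> = (\<Sum>A\<in>Pow S. (-1) ^ card A * g (S - A))"
    by (rule sum.reindex_bij_witness[where i = "\<lambda>A. S - A" and j = "\<lambda>D. S - D"])
       (use assms in \<open>auto simp: double_diff card_Diff_subset finite_subset\<close>)
  finally show ?thesis .
qed

lemma exists_distinct_subset_sums:
  assumes "finite S"
  obtains d :: "'a \<Rightarrow> nat" where "inj_on (sum d) (Pow S)"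
proof -
  obtain f :: "'a \<Rightarrow> nat" where f: "inj_on f S"
    using finite_imp_inj_to_nat_seg[OF assms] by blast
  have "sum (\<lambda>i. 2 ^ f i :: nat) B = set_encode (f ` B)" if "B \<subseteq> S" for B
    using inj_on_subset[OF f that] by (simp add: set_encode_def sum.reindex o_def)
  moreover have "inj_on (\<lambda>B. set_encode (f ` B)) (Pow S)"
  proof (rule inj_onI)
    fix B C assume BC: "B \<in> Pow S" "C \<in> Pow S" "set_encode (f ` B) = set_encode (f ` C)"
    then have "finite (f ` B)" "finite (f ` C)" using assms by (auto intro: finite_subset)
    with BC have "f ` B = f ` C" by (simp add: set_encode_eq)
    then show "B = C" using f BC by (auto simp: inj_on_image_eq_iff)
  qed
  ultimately have "inj_on (sum (\<lambda>i. 2 ^ f i :: nat)) (Pow S)" by (subst inj_on_cong) auto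
  then show thesis by (rule that)
qed

lemma sum_fun_upd_notin:
  "a \<notin> B \<Longrightarrow> sum (u(a := x)) B = sum u B"
  by (intro sum.cong) auto

lemma sum_fun_upd_insert:
  "finite B \<Longrightarrow> a \<notin> B \<Longrightarrow> sum (u(a := x)) (insert a B) = x + sum u B"
  by (simp add: sum_fun_upd_notin del: fun_upd_apply) simp

lemma sum_fun_upd_add:
  fixes u :: "'a \<Rightarrow> 'b :: ab_group_add"
  assumes "finite B"
  shows "sum (u(a := u a + y)) B = sum u B + (if a \<in> B then y else 0)"
proof (cases "a \<in> B")
  case True
  then have "B = insert a (B - {a})" by blast
  then show ?thesis
    using True assms sum_fun_upd_insert[of "B - {a}" a u "u a + y"]
    by (simp add: sum.remove[of B a] add_ac)
qed (simp add: sum_fun_upd_notin del: fun_upd_apply)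

lemma sum_fun_upd_merge:
  fixes u :: "'a \<Rightarrow> 'b :: ab_group_add"
  assumes "finite S" "a \<notin> S" "A \<subseteq> S"
  shows "sum (u(a := u a + sum u A)) (insert a (S - A)) = sum u (insert a S)"
  using assms sum_fun_upd_insert[of "S - A" a u "u a + sum u A"]
  by (simp add: sum.subset_diff[of A S] add_ac del: fun_upd_apply)

section \<open>Theta-like functions and the subset recursion\<close>

locale theta_like =
  fixes h :: "complex \<Rightarrow> complex" and \<tau> c :: complex
  assumes holomorphic: "h holomorphic_on UNIV"
    and odd: "h (- z) = - h z"
    and deriv_at_0: "deriv h 0 = 1"
    and antiperiod: "h (z + 2 * pi * \<i>) = - h z"
    and quasiperiod: "h (z + \<tau>) = c * exp (- z) * h z"
    and multiplier_nonzero: "c \<noteq> 0"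
    and Re_tau: "Re \<tau> \<noteq> 0"
    and zeros: "h z = 0 \<Longrightarrow> \<exists>k l :: int. z = of_int k * \<tau> + of_int l * (2 * pi * \<i>)"
begin

text \<open>Above, \<open>sderiv k\<close> was written \<open>E\<^sub>k\<close>, \<open>npoint\<close> was \<open>F\<close> and \<open>npoint_numer\<close> was \<open>T\<close>.\<close>

definition sderiv :: "nat \<Rightarrow> complex \<Rightarrow> complex" where
  "sderiv k z = (-1) ^ k * (deriv ^^ k) h z"

function npoint :: "('a \<Rightarrow> complex) \<Rightarrow> 'a set \<Rightarrow> complex" where
  "npoint u S = (if S = {} \<or> infinite S then 1
     else - (\<Sum>B | B \<subset> S. sderiv (card (S - B)) (sum u B) * npoint u B) / h (sum u S))"
  by auto
termination
  by (relation "Wellfounded.measure (\<lambda>(u, S). card S)") (auto intro: psubset_card_mono)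

declare npoint.simps [simp del]

definition npoint_numer :: "('a \<Rightarrow> complex) \<Rightarrow> 'a set \<Rightarrow> complex" where
  "npoint_numer u S = - (\<Sum>B | B \<subset> S. sderiv (card (S - B)) (sum u B) * npoint u B)"

definition npoint_sum_Suc :: "('a \<Rightarrow> complex) \<Rightarrow> 'a set \<Rightarrow> complex" where
  "npoint_sum_Suc u S = (\<Sum>B\<in>Pow S. sderiv (Suc (card (S - B))) (sum u B) * npoint u B)"

lemma npoint_empty [simp]: "npoint u {} = 1"
  by (simp add: npoint.simps)

lemma npoint_eq: "finite S \<Longrightarrow> S \<noteq> {} \<Longrightarrow> npoint u S = npoint_numer u S / h (sum u S)"
  by (subst npoint.simps) (simp add: npoint_numer_def)

lemma npoint_cong:
  assumes "finite S" "\<And>i. i \<in> S \<Longrightarrow> u i = v i"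
  shows "npoint u S = npoint v S"
  using assms
proof (induction S rule: finite_psubset_induct)
  case (psubset S)
  have sums: "sum u B = sum v B" if "B \<subseteq> S" for B
    using psubset.prems that by (intro sum.cong) auto
  have "npoint u B = npoint v B" if "B \<subset> S" for B
    using that psubset.prems by (intro psubset.IH) auto
  then have "npoint_numer u S = npoint_numer v S"
    unfolding npoint_numer_def using sums by (intro arg_cong[where f = uminus] sum.cong) auto
  then show ?case
    using psubset.hyps sums[of S] by (cases "S = {}") (simp_all add: npoint_eq)
qed

lemma npoint_sum_Suc_cong:
  assumes "finite S" "\<And>i. i \<in> S \<Longrightarrow> u i = v i"
  shows "npoint_sum_Suc u S = npoint_sum_Suc v S"
  unfolding npoint_sum_Suc_def
proof (intro sum.cong refl)
  fix B assume "B \<in> Pow S"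
  then have "npoint u B = npoint v B" "sum u B = sum v B"
    using assms by (auto intro!: npoint_cong sum.cong intro: finite_subset)
  then show "sderiv (Suc (card (S - B))) (sum u B) * npoint u B =
      sderiv (Suc (card (S - B))) (sum v B) * npoint v B" by simp
qed

lemma npoint_numer_insert:
  assumes "finite S" "a \<notin> S"
  shows "npoint_numer u (insert a S) = - npoint_sum_Suc u S
    - (\<Sum>B | B \<subset> S. sderiv (card (S - B)) (u a + sum u B) * npoint u (insert a B))"
proof -
  have "sderiv (card (insert a S - B)) (sum u B) = sderiv (Suc (card (S - B))) (sum u B)"
    if "B \<subseteq> S" for B
  proof -
    have "insert a S - B = insert a (S - B)" using that assms by auto
    then show ?thesis using assms by simp
  qed
  moreover have "sderiv (card (insert a S - insert a B)) (sum u (insert a B)) =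
      sderiv (card (S - B)) (u a + sum u B)" if "B \<subset> S" for B
  proof -
    have "insert a S - insert a B = S - B" "a \<notin> B" "finite B"
      using that assms by (auto intro: finite_subset)
    then show ?thesis by simp
  qed
  ultimately show ?thesis
    using assms by (simp add: npoint_numer_def npoint_sum_Suc_def sum_proper_insert)
qed

lemma sderiv_0: "sderiv 0 = h"
  by (auto simp: sderiv_def)

lemma sderiv_has_field_derivative: "(sderiv k has_field_derivative - sderiv (Suc k) z) (at z)"
  using has_field_derivative_higher_deriv[OF holomorphic, of z k]
  unfolding sderiv_def[abs_def] by (auto intro!: derivative_eq_intros)

lemma h_has_field_derivative: "(h has_field_derivative deriv h z) (at z)"
  using holomorphic by (intro holomorphic_derivI) auto

lemma sderiv_1: "sderiv (Suc 0) z = - deriv h z"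
  by (simp add: sderiv_def)

lemma isCont_sderiv: "isCont (sderiv k) z"
  using sderiv_has_field_derivative by (rule DERIV_isCont)

lemma sderiv_holomorphic [holomorphic_intros]:
  assumes "g holomorphic_on A"
  shows "(\<lambda>z. sderiv k (g z)) holomorphic_on A"
proof -
  have "sderiv k holomorphic_on UNIV"
    using sderiv_has_field_derivative by (auto simp: holomorphic_on_def field_differentiable_def
        intro: has_field_derivative_at_within)
  then show ?thesis
    using holomorphic_on_compose_gen[OF assms, of "sderiv k" UNIV] by (simp add: o_def)
qed

lemma h_holomorphic [holomorphic_intros]: "g holomorphic_on A \<Longrightarrow> (\<lambda>z. h (g z)) holomorphic_on A"
  using sderiv_holomorphic[of g A 0] by (simp add: sderiv_0)

lemma h_0 [simp]: "h 0 = 0"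
  using odd[of 0] by simp

lemma h_minus_eq_0_iff: "h (- z) = 0 \<longleftrightarrow> h z = 0"
  by (simp add: odd)

lemma h_tau_eq_0_iff: "h (z + \<tau>) = 0 \<longleftrightarrow> h z = 0"
  using multiplier_nonzero by (simp add: quasiperiod)

lemma npoint_numer_singleton [simp]: "npoint_numer u {a} = 1"
proof -
  have "{B. B \<subset> {a}} = {{}}" by auto
  then show ?thesis by (simp add: npoint_numer_def sderiv_1 deriv_at_0)
qed

section \<open>The difference equation\<close>

lemma sderiv_add_tau:
  assumes "finite X"
  shows "sderiv (card X) (z + \<tau>) = c * exp (- z) * (\<Sum>C\<in>Pow X. sderiv (card C) z)"
  using assms
proof (induction X arbitrary: z rule: finite_induct)
  case empty
  show ?case by (simp add: sderiv_0 quasiperiod)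
next
  case (insert x X)
  have "((\<lambda>z. sderiv (card X) (z + \<tau>)) has_field_derivative - sderiv (Suc (card X)) (z + \<tau>)) (at z)"
    using sderiv_has_field_derivative[of "card X" "z + \<tau>"] by (simp only: DERIV_shift)
  moreover have "((\<lambda>z. c * exp (- z) * (\<Sum>C\<in>Pow X. sderiv (card C) z)) has_field_derivative
      - (c * exp (- z) * ((\<Sum>C\<in>Pow X. sderiv (card C) z)
        + (\<Sum>C\<in>Pow X. sderiv (Suc (card C)) z)))) (at z)"
    by (auto intro!: derivative_eq_intros sderiv_has_field_derivative[THEN DERIV_chain2]
        simp: sum_negf algebra_simps)
  ultimately have "- sderiv (Suc (card X)) (z + \<tau>) =
      - (c * exp (- z) * ((\<Sum>C\<in>Pow X. sderiv (card C) z) + (\<Sum>C\<in>Pow X. sderiv (Suc (card C)) z)))"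
    unfolding insert.IH by (rule DERIV_unique)
  moreover have "(\<Sum>C\<in>Pow X. sderiv (card (insert x C)) z) = (\<Sum>C\<in>Pow X. sderiv (Suc (card C)) z)"
    using insert.hyps by (intro sum.cong refl arg_cong2[where f = sderiv] card_insert_disjoint)
      (auto intro: finite_subset)
  ultimately show ?case
    using insert.hyps by (simp add: sum_Pow_insert)
qed

definition deriv_ratio :: "nat \<Rightarrow> complex \<Rightarrow> complex" where
  "deriv_ratio k z = (if k = 0 then 1 else sderiv k z / h z)"

lemma deriv_ratio_0 [simp]: "deriv_ratio 0 z = 1"
  by (simp add: deriv_ratio_def)

text \<open>The recursion in the presence of an extra variable \<open>x\<close>, as a unitriangular operator.\<close>

definition ratio_sum :: "('a \<Rightarrow> complex) \<Rightarrow> complex \<Rightarrow> ('a set \<Rightarrow> complex) \<Rightarrow> 'a set \<Rightarrow> complex" where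
  "ratio_sum u x t S = (\<Sum>B\<in>Pow S. deriv_ratio (card (S - B)) (x + sum u B) * t B)"

lemma ratio_sum_proper:
  "finite S \<Longrightarrow> ratio_sum u x t S =
    t S + (\<Sum>B | B \<subset> S. deriv_ratio (card (S - B)) (x + sum u B) * t B)"
  by (simp add: ratio_sum_def sum_Pow_proper)

lemma ratio_sum_inject:
  assumes "finite S" "\<And>D. D \<subseteq> S \<Longrightarrow> ratio_sum u x t D = ratio_sum u x t' D"
  shows "t S = t' S"
  using assms
proof (induction S rule: finite_psubset_induct)
  case (psubset S)
  have "t B = t' B" if "B \<subset> S" for B
    using that psubset.prems by (intro psubset.IH) auto
  then show ?case
    using psubset.prems[of S] psubset.hyps by (simp add: ratio_sum_proper)
qed

lemma ratio_sum_npoint_numer: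
  assumes "finite S" "a \<notin> S"
  shows "ratio_sum u x (\<lambda>B. npoint_numer (u(a := x)) (insert a B)) S = - npoint_sum_Suc u S"
proof -
  have "deriv_ratio (card (S - B)) (x + sum u B) * npoint_numer (u(a := x)) (insert a B) =
      sderiv (card (S - B)) (x + sum (u(a := x)) B) * npoint (u(a := x)) (insert a B)"
    if "B \<subset> S" for B
  proof -
    have "a \<notin> B" "finite B" "card (S - B) \<noteq> 0"
      using that assms by (auto intro: finite_subset)
    then show ?thesis
      by (simp add: deriv_ratio_def npoint_eq sum_fun_upd_notin sum_fun_upd_insert
          del: sum.insert fun_upd_apply)
  qed
  moreover have "npoint_sum_Suc (u(a := x)) S = npoint_sum_Suc u S"
    using assms by (intro npoint_sum_Suc_cong) auto
  ultimately show ?thesis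
    using assms npoint_numer_insert[OF assms, of "u(a := x)"] by (simp add: ratio_sum_proper)
qed

lemma deriv_ratio_add_tau:
  assumes "finite X" "h z \<noteq> 0 \<or> X = {}"
  shows "deriv_ratio (card X) (z + \<tau>) = (\<Sum>C\<in>Pow X. deriv_ratio (card C) z)"
proof (cases "X = {}")
  case False
  then have "deriv_ratio (card X) (z + \<tau>) = (\<Sum>C\<in>Pow X. sderiv (card C) z / h z)"
    using assms multiplier_nonzero
    by (simp add: deriv_ratio_def sderiv_add_tau quasiperiod sum_divide_distrib)
  also have "\<dots> = (\<Sum>C\<in>Pow X. deriv_ratio (card C) z)"
    using assms False by (intro sum.cong) (auto simp: deriv_ratio_def sderiv_0)
  finally show ?thesis .
qed simp

lemma ratio_sum_add_tau:
  assumes "finite S" "\<And>B. B \<subset> S \<Longrightarrow> h (x + sum u B) \<noteq> 0"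
  shows "ratio_sum u (x + \<tau>) t S = (\<Sum>D\<in>Pow S. ratio_sum u x t D)"
proof -
  have "ratio_sum u (x + \<tau>) t S =
      (\<Sum>B\<in>Pow S. \<Sum>C\<in>Pow (S - B). deriv_ratio (card C) (x + sum u B) * t B)"
    unfolding ratio_sum_def
  proof (intro sum.cong refl)
    fix B assume "B \<in> Pow S"
    then have "deriv_ratio (card (S - B)) (x + sum u B + \<tau>) =
        (\<Sum>C\<in>Pow (S - B). deriv_ratio (card C) (x + sum u B))"
      using assms by (intro deriv_ratio_add_tau) auto
    then show "deriv_ratio (card (S - B)) (x + \<tau> + sum u B) * t B =
        (\<Sum>C\<in>Pow (S - B). deriv_ratio (card C) (x + sum u B) * t B)"
      by (simp add: add_ac sum_distrib_right)
  qed
  also have "\<dots> = (\<Sum>D\<in>Pow S. ratio_sum u x t D)"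
    unfolding ratio_sum_def
    by (rule sum_Pow_Pow_diff[symmetric]) fact
  finally show ?thesis .
qed

lemma ratio_sum_merge:
  assumes "finite S"
  shows "(\<Sum>A\<in>Pow S. (-1) ^ card A * ratio_sum u (x + sum u A) (t A) (S - A)) =
    ratio_sum u x (\<lambda>B. \<Sum>A\<in>Pow B. (-1) ^ card A * t A (B - A)) S"
proof -
  have "ratio_sum u x (\<lambda>B. \<Sum>A\<in>Pow B. (-1) ^ card A * t A (B - A)) S =
      (\<Sum>B\<in>Pow S. \<Sum>A\<in>Pow B. (-1) ^ card A *
        (deriv_ratio (card (S - A - (B - A))) (x + sum u A + sum u (B - A)) * t A (B - A)))"
    unfolding ratio_sum_def sum_distrib_left
  proof (intro sum.cong refl)
    fix B A assume "B \<in> Pow S" "A \<in> Pow B"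
    then have "S - A - (B - A) = S - B" "sum u A + sum u (B - A) = sum u B"
      using assms finite_subset[of B S] by (auto simp: sum.subset_diff[of A B])
    then show "deriv_ratio (card (S - B)) (x + sum u B) * ((-1) ^ card A * t A (B - A)) =
        (-1) ^ card A *
          (deriv_ratio (card (S - A - (B - A))) (x + sum u A + sum u (B - A)) * t A (B - A))"
      by (simp add: add.assoc)
  qed
  also have "\<dots> = (\<Sum>A\<in>Pow S. \<Sum>Y\<in>Pow (S - A). (-1) ^ card A *
      (deriv_ratio (card (S - A - Y)) (x + sum u A + sum u Y) * t A Y))"
    by (rule sum_Pow_Pow_diff) fact
  finally show ?thesis by (simp add: ratio_sum_def sum_distrib_left)
qed

theorem npoint_numer_add_tau:
  assumes "finite S" "a \<notin> S" "\<And>B. B \<subset> S \<Longrightarrow> h (x + sum u B) \<noteq> 0"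
  shows "npoint_numer (u(a := x + \<tau>)) (insert a S) =
    (\<Sum>A\<in>Pow S. (-1) ^ card A * npoint_numer (u(a := x + sum u A)) (insert a (S - A)))"
proof (rule ratio_sum_inject[OF assms(1)])
  let ?T = "\<lambda>y B. npoint_numer (u(a := y)) (insert a B)"
  fix D assume "D \<subseteq> S"
  then have D: "finite D" "a \<notin> D" using assms by (auto intro: finite_subset)
  have "ratio_sum u x (?T (x + \<tau>)) D = (\<Sum>A\<in>Pow D. (-1) ^ card A * - npoint_sum_Suc u (D - A))"
  proof (rule moebius_inversion_Pow[OF D(1)])
    fix X assume "X \<subseteq> D"
    with D \<open>D \<subseteq> S\<close> have X: "finite X" "a \<notin> X" "X \<subseteq> S" by (auto intro: finite_subset)
    have "- npoint_sum_Suc u X = ratio_sum u (x + \<tau>) (?T (x + \<tau>)) X"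
      by (rule ratio_sum_npoint_numer[OF X(1,2), symmetric])
    also have "\<dots> = (\<Sum>B\<in>Pow X. ratio_sum u x (?T (x + \<tau>)) B)"
      using X assms(3) by (intro ratio_sum_add_tau) auto
    finally show "- npoint_sum_Suc u X = \<dots>" .
  qed
  also have "\<dots> = (\<Sum>A\<in>Pow D. (-1) ^ card A * ratio_sum u (x + sum u A) (?T (x + sum u A)) (D - A))"
    using D by (simp add: ratio_sum_npoint_numer)
  also have "\<dots> = ratio_sum u x (\<lambda>B. \<Sum>A\<in>Pow B. (-1) ^ card A * ?T (x + sum u A) (B - A)) D"
    using D(1) by (rule ratio_sum_merge)
  finally show "ratio_sum u x (?T (x + \<tau>)) D = \<dots>" .
qed

end

section \<open>The Hessenberg determinant and sums over permutations\<close>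

text \<open>Cramer's rule for the last coordinate of \<open>w\<close>, followed by expansion along the last column.\<close>

lemma det_hessenberg:
  fixes M :: "'a :: comm_ring_1 mat"
  assumes M: "M \<in> carrier_mat (Suc n) (Suc n)"
    and hessenberg: "\<And>i j. i \<le> n \<Longrightarrow> Suc j < i \<Longrightarrow> M $$ (i, j) = 0"
    and w: "w \<in> carrier_vec (Suc n)" "w $ n = 1" and Mw: "M *\<^sub>v w = d \<cdot>\<^sub>v unit_vec (Suc n) 0"
  shows "det M = (-1) ^ n * d * (\<Prod>i<n. M $$ (Suc i, i))"
proof -
  define N where "N = replace_col M (M *\<^sub>v w) n"
  define D where "D = mat_delete N 0 n"
  have N: "N \<in> carrier_mat (Suc n) (Suc n)" using M by (simp add: N_def replace_col_def)
  then have D: "D \<in> carrier_mat n n" by (simp add: D_def mat_delete_def)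
  have N_last: "N $$ (i, n) = (if i = 0 then d else 0)" if "i < Suc n" for i
    using that M by (simp add: N_def replace_col_def Mw)
  have D_index: "D $$ (i, j) = M $$ (Suc i, j)" if "i < n" "j < n" for i j
    using that M by (simp add: D_def N_def mat_delete_def replace_col_def)
  have "upper_triangular D"
    using D D_index hessenberg by (intro upper_triangularI) auto
  then have "det D = prod_list (diag_mat D)" using D by (rule det_upper_triangular)
  also have "\<dots> = (\<Prod>i<n. M $$ (Suc i, i))"
    using D D_index by (simp add: prod_list_diag_prod atLeast0LessThan)
  finally have det_D: "det D = \<dots>" .
  have "det M = det N"
    using cramer_lemma_mat[OF M w(1), of n] w(2) by (simp add: N_def)
  also have "\<dots> = (\<Sum>i<Suc n. N $$ (i, n) * cofactor N i n)"
    using N by (rule laplace_expansion_column) simp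
  also have "\<dots> = (\<Sum>i<Suc n. if i = 0 then d * cofactor N 0 n else 0)"
    by (intro sum.cong refl) (simp add: N_last)
  also have "\<dots> = d * ((-1) ^ n * det D)"
    by (simp add: cofactor_def D_def del: sum.lessThan_Suc)
  finally show ?thesis by (simp add: det_D)
qed

lemma permutations_of_set_prefix_eq:
  assumes "ys \<in> permutations_of_set B" "B \<subseteq> S"
  shows "{xs \<in> permutations_of_set S. take (card B) xs = ys} = (@) ys ` permutations_of_set (S - B)"
proof (intro equalityI subsetI)
  have ys: "set ys = B" "distinct ys" "length ys = card B"
    using assms(1) by (auto simp: permutations_of_set_def distinct_card)
  fix xs
  {
    assume "xs \<in> {xs \<in> permutations_of_set S. take (card B) xs = ys}"
    then have xs: "set xs = S" "distinct xs" "take (card B) xs = ys"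
      by (auto simp: permutations_of_set_def)
    then obtain zs where zs: "xs = ys @ zs" by (metis append_take_drop_id)
    with xs ys have "zs \<in> permutations_of_set (S - B)" by (auto simp: permutations_of_set_def)
    with zs show "xs \<in> (@) ys ` permutations_of_set (S - B)" by blast
  next
    assume "xs \<in> (@) ys ` permutations_of_set (S - B)"
    then show "xs \<in> {xs \<in> permutations_of_set S. take (card B) xs = ys}"
      using ys assms(2) by (auto simp: permutations_of_set_def)
  }
qed

lemma sum_permutations_of_set_take:
  fixes f :: "'a list \<Rightarrow> 'b :: {comm_semiring_1, semiring_char_0}"
  assumes "finite S" "l \<le> card S"
  shows "(\<Sum>xs\<in>permutations_of_set S. f (take l xs)) =
    (\<Sum>B | B \<subseteq> S \<and> card B = l. \<Sum>ys\<in>permutations_of_set B. fact (card S - l) * f ys)"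
proof -
  define prefixes where "prefixes = {ys. distinct ys \<and> set ys \<subseteq> S \<and> length ys = l}"
  have "finite {xs. set xs \<subseteq> S \<and> length xs = l}" using assms(1) by (rule finite_lists_length_eq)
  then have fin: "finite prefixes" by (rule rev_finite_subset) (auto simp: prefixes_def)
  have "(\<Sum>xs\<in>permutations_of_set S. f (take l xs)) =
      (\<Sum>ys\<in>prefixes. \<Sum>xs | xs \<in> permutations_of_set S \<and> take l xs = ys. f (take l xs))"
    using assms fin finite_permutations_of_set[of S]
    by (intro sum.group[symmetric])
      (auto simp: prefixes_def permutations_of_setD length_finite_permutations_of_set
        dest!: in_set_takeD)
  also have "\<dots> = (\<Sum>ys\<in>prefixes. fact (card S - l) * f ys)"
  proof (intro sum.cong refl)
    fix ys assume "ys \<in> prefixes"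
    then have ys: "ys \<in> permutations_of_set (set ys)" "set ys \<subseteq> S" "card (set ys) = l"
      by (auto simp: prefixes_def distinct_card)
    then have "card {xs \<in> permutations_of_set S. take l xs = ys} = fact (card S - l)"
      using permutations_of_set_prefix_eq[OF ys(1,2)] assms(1)
      by (simp add: card_image inj_on_def card_Diff_subset)
    then show "(\<Sum>xs | xs \<in> permutations_of_set S \<and> take l xs = ys. f (take l xs)) =
        fact (card S - l) * f ys"
      by simp
  qed
  also have "\<dots> = (\<Sum>B | B \<subseteq> S \<and> card B = l. \<Sum>ys | ys \<in> prefixes \<and> set ys = B. fact (card S - l) * f ys)"
    using assms(1) fin by (intro sum.group[symmetric]) (auto simp: prefixes_def distinct_card)
  also have "\<dots> = (\<Sum>B | B \<subseteq> S \<and> card B = l. \<Sum>ys\<in>permutations_of_set B. fact (card S - l) * f ys)"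
    by (intro sum.cong refl) (auto simp: prefixes_def permutations_of_set_def distinct_card)
  finally show ?thesis .
qed

lemma bij_betw_permutes_permutations_of_set:
  "bij_betw (\<lambda>\<sigma>. map \<sigma> [0..<n]) {\<sigma>. \<sigma> permutes {..<n}} (permutations_of_set {..<n})"
    (is "bij_betw ?list ?perms _")
proof -
  have inj: "inj_on ?list ?perms"
  proof (rule inj_onI, rule ext)
    fix \<sigma> \<rho> :: "nat \<Rightarrow> nat" and x
    assume "\<sigma> \<in> ?perms" "\<rho> \<in> ?perms" "?list \<sigma> = ?list \<rho>"
    then show "\<sigma> x = \<rho> x" by (cases "x < n") (auto simp: permutes_def)
  qed
  moreover have "?list ` ?perms \<subseteq> permutations_of_set {..<n}"
    by (auto simp: permutations_of_set_def distinct_map permutes_inj_on atLeast0LessThan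
        permutes_image simp flip: image_image)
  moreover have "card (?list ` ?perms) = card (permutations_of_set {..<n})"
    using inj by (simp add: card_image card_permutations)
  ultimately show ?thesis
    unfolding bij_betw_def by (intro conjI card_subset_eq) auto
qed

lemma exists_permutes_prefix:
  assumes "B \<subseteq> {..<n}"
  obtains \<sigma> where "\<sigma> permutes {..<n}" "take (card B) (map \<sigma> [0..<n]) \<in> permutations_of_set B"
proof -
  have "finite B" using assms by (rule finite_subset) simp
  then have "permutations_of_set B \<noteq> {}" "permutations_of_set ({..<n} - B) \<noteq> {}" by simp_all
  then obtain xs ys where "xs \<in> permutations_of_set B" "ys \<in> permutations_of_set ({..<n} - B)"
    by blast
  then have xs: "xs @ ys \<in> permutations_of_set {..<n}" "length xs = card B"
      "xs \<in> permutations_of_set B"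
    using assms by (auto simp: permutations_of_set_def distinct_card)
  then have "xs @ ys \<in> (\<lambda>\<sigma>. map \<sigma> [0..<n]) ` {\<sigma>. \<sigma> permutes {..<n}}"
    by (simp only: bij_betw_imp_surj_on[OF bij_betw_permutes_permutations_of_set])
  then obtain \<sigma> where "\<sigma> permutes {..<n}" "map \<sigma> [0..<n] = xs @ ys" by auto
  then show thesis using that[of \<sigma>] xs(3) by (simp add: xs(2)[symmetric])
qed

lemma sum_list_permutations_of_set:
  fixes u :: "'a \<Rightarrow> 'b :: comm_monoid_add"
  shows "xs \<in> permutations_of_set S \<Longrightarrow> (\<Sum>x\<leftarrow>xs. u x) = sum u S"
  by (auto simp: permutations_of_set_def sum_list_distinct_conv_sum_set)

context theta_like
begin

function npoint_term :: "('a \<Rightarrow> complex) \<Rightarrow> 'a list \<Rightarrow> complex" where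
  "npoint_term u xs = (if xs = [] then 1
     else - (\<Sum>l<length xs. sderiv (length xs - l) (\<Sum>x\<leftarrow>take l xs. u x) / fact (length xs - l)
              * npoint_term u (take l xs)) / h (\<Sum>x\<leftarrow>xs. u x))"
  by auto
termination
  by (relation "Wellfounded.measure (\<lambda>(u, xs). length xs)") auto

declare npoint_term.simps [simp del]

definition npoint_numer_term :: "('a \<Rightarrow> complex) \<Rightarrow> 'a list \<Rightarrow> complex" where
  "npoint_numer_term u xs = - (\<Sum>l<length xs. sderiv (length xs - l) (\<Sum>x\<leftarrow>take l xs. u x)
      / fact (length xs - l) * npoint_term u (take l xs))"

lemma npoint_term_Nil [simp]: "npoint_term u [] = 1"
  by (simp add: npoint_term.simps)

lemma npoint_term_eq:
  "xs \<noteq> [] \<Longrightarrow> npoint_term u xs = npoint_numer_term u xs / h (\<Sum>x\<leftarrow>xs. u x)"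
  by (subst npoint_term.simps) (simp add: npoint_numer_term_def)

lemma npoint_term_recursion:
  assumes "xs \<noteq> []" "h (\<Sum>x\<leftarrow>xs. u x) \<noteq> 0"
  shows "(\<Sum>l\<le>length xs. sderiv (length xs - l) (\<Sum>x\<leftarrow>take l xs. u x) / fact (length xs - l)
      * npoint_term u (take l xs)) = 0"
proof -
  have "{..length xs} = insert (length xs) {..<length xs}" by auto
  then show ?thesis
    using assms by (simp add: npoint_term_eq npoint_numer_term_def sderiv_0)
qed

lemma sum_prefixes_npoint_term:
  assumes "finite S" "l < card S"
    and npoint: "\<And>B. B \<subset> S \<Longrightarrow> npoint u B = (\<Sum>xs\<in>permutations_of_set B. npoint_term u xs)"
  shows "(\<Sum>xs\<in>permutations_of_set S. sderiv (card S - l) (\<Sum>x\<leftarrow>take l xs. u x) / fact (card S - l)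
      * npoint_term u (take l xs)) =
    (\<Sum>B | B \<in> {B. B \<subset> S} \<and> card B = l. sderiv (card (S - B)) (sum u B) * npoint u B)"
proof -
  have proper: "{B. B \<subseteq> S \<and> card B = l} = {B. B \<in> {B. B \<subset> S} \<and> card B = l}"
    using assms(2) by auto
  show ?thesis
    unfolding sum_permutations_of_set_take[OF assms(1) less_imp_le[OF assms(2)],
        of "\<lambda>ys. sderiv (card S - l) (\<Sum>x\<leftarrow>ys. u x) / fact (card S - l) * npoint_term u ys"] proper
  proof (intro sum.cong refl)
    fix B assume "B \<in> {B. B \<in> {B. B \<subset> S} \<and> card B = l}"
    then have B: "B \<subset> S" "card (S - B) = card S - l"
      using assms(1) by (auto simp: card_Diff_subset finite_subset)
    have "(\<Sum>ys\<in>permutations_of_set B. fact (card S - l)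
          * (sderiv (card S - l) (\<Sum>x\<leftarrow>ys. u x) / fact (card S - l) * npoint_term u ys)) =
        (\<Sum>ys\<in>permutations_of_set B. sderiv (card (S - B)) (sum u B) * npoint_term u ys)"
      using B by (intro sum.cong refl) (simp add: sum_list_permutations_of_set)
    also have "\<dots> = sderiv (card (S - B)) (sum u B) * npoint u B"
      using B npoint[of B] by (simp add: sum_distrib_left)
    finally show "(\<Sum>ys\<in>permutations_of_set B. fact (card S - l)
        * (sderiv (card S - l) (\<Sum>x\<leftarrow>ys. u x) / fact (card S - l) * npoint_term u ys)) = \<dots>" .
  qed
qed

lemma npoint_numer_eq_sum_terms_step:
  assumes "finite S"
    and "\<And>B. B \<subset> S \<Longrightarrow> npoint u B = (\<Sum>xs\<in>permutations_of_set B. npoint_term u xs)"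
  shows "npoint_numer u S = (\<Sum>xs\<in>permutations_of_set S. npoint_numer_term u xs)"
proof -
  let ?summand = "\<lambda>l xs. sderiv (card S - l) (\<Sum>x\<leftarrow>take l xs. u x) / fact (card S - l)
    * npoint_term u (take l xs)"
  have "(\<Sum>xs\<in>permutations_of_set S. npoint_numer_term u xs) =
      - (\<Sum>xs\<in>permutations_of_set S. \<Sum>l<card S. ?summand l xs)"
    unfolding npoint_numer_term_def sum_negf
    by (intro arg_cong[where f = uminus] sum.cong) (auto simp: length_finite_permutations_of_set)
  also have "\<dots> = - (\<Sum>l<card S. \<Sum>xs\<in>permutations_of_set S. ?summand l xs)"
    by (subst sum.swap) (rule refl)
  also have "\<dots> = - (\<Sum>l<card S. \<Sum>B | B \<in> {B. B \<subset> S} \<and> card B = l.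
      sderiv (card (S - B)) (sum u B) * npoint u B)"
    using assms by (intro arg_cong[where f = uminus] sum.cong refl sum_prefixes_npoint_term) auto
  also have "\<dots> = npoint_numer u S"
    unfolding npoint_numer_def using assms(1)
    by (intro arg_cong[where f = uminus] sum.group) (auto intro: psubset_card_mono)
  finally show ?thesis ..
qed

lemma npoint_eq_sum_terms:
  assumes "finite S"
  shows "npoint u S = (\<Sum>xs\<in>permutations_of_set S. npoint_term u xs)"
  using assms
proof (induction S rule: finite_psubset_induct)
  case (psubset S)
  show ?case
  proof (cases "S = {}")
    case False
    have "npoint u S = (\<Sum>xs\<in>permutations_of_set S. npoint_numer_term u xs / h (sum u S))"
      using psubset False
      by (simp add: npoint_eq npoint_numer_eq_sum_terms_step[of S u] sum_divide_distrib)
    also have "\<dots> = (\<Sum>xs\<in>permutations_of_set S. npoint_term u xs)"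
    proof (intro sum.cong refl)
      fix xs assume xs: "xs \<in> permutations_of_set S"
      then have "xs \<noteq> []" using False by (auto simp: permutations_of_set_def)
      with xs show "npoint_numer_term u xs / h (sum u S) = npoint_term u xs"
        by (simp add: npoint_term_eq sum_list_permutations_of_set)
    qed
    finally show ?thesis .
  qed simp
qed

lemma npoint_numer_eq_sum_terms:
  "finite S \<Longrightarrow> npoint_numer u S = (\<Sum>xs\<in>permutations_of_set S. npoint_numer_term u xs)"
  by (rule npoint_numer_eq_sum_terms_step) (auto intro: npoint_eq_sum_terms finite_subset)

definition deriv_mat :: "('a \<Rightarrow> complex) \<Rightarrow> 'a list \<Rightarrow> complex mat" where
  "deriv_mat u xs = mat (length xs) (length xs) (\<lambda>(i, j). if i \<le> j + 1
     then (deriv ^^ (j + 1 - i)) h (\<Sum>x\<leftarrow>take (length xs - (j + 1)) xs. u x) / fact (j + 1 - i)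
     else 0)"

definition signed_terms :: "('a \<Rightarrow> complex) \<Rightarrow> 'a list \<Rightarrow> complex vec" where
  "signed_terms u xs = vec (length xs) (\<lambda>j. (-1) ^ (length xs - (j + 1))
     * npoint_term u (take (length xs - (j + 1)) xs))"

lemma deriv_mat_mult_signed_terms_index:
  assumes "i < length xs"
  shows "(deriv_mat u xs *\<^sub>v signed_terms u xs) $ i = (-1) ^ (length xs - i) *
    (\<Sum>l | l < length xs \<and> l \<le> length xs - i. sderiv (length xs - i - l) (\<Sum>x\<leftarrow>take l xs. u x)
       / fact (length xs - i - l) * npoint_term u (take l xs))"
proof -
  define n where "n = length xs"
  let ?p = "\<lambda>l. \<Sum>x\<leftarrow>take l xs. u x"
  have "(deriv_mat u xs *\<^sub>v signed_terms u xs) $ i =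
      (\<Sum>j<n. if i \<le> j + 1 then (deriv ^^ (j + 1 - i)) h (?p (n - (j + 1))) / fact (j + 1 - i)
         * ((-1) ^ (n - (j + 1)) * npoint_term u (take (n - (j + 1)) xs)) else 0)"
    using assms by (auto simp: deriv_mat_def signed_terms_def scalar_prod_def n_def atLeast0LessThan
        intro!: sum.cong)
  also have "\<dots> = (\<Sum>l<n. if l \<le> n - i then (deriv ^^ (n - i - l)) h (?p l) / fact (n - i - l)
         * ((-1) ^ l * npoint_term u (take l xs)) else 0)"
    using assms
    by (intro sum.reindex_bij_witness[where i = "\<lambda>l. n - (l + 1)" and j = "\<lambda>j. n - (j + 1)"])
      (auto simp: n_def)
  also have "\<dots> = (\<Sum>l | l < n \<and> l \<le> n - i. (deriv ^^ (n - i - l)) h (?p l) / fact (n - i - l)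
         * ((-1) ^ l * npoint_term u (take l xs)))"
    by (intro sum.mono_neutral_cong_right) auto
  also have "\<dots> = (-1) ^ (n - i) * (\<Sum>l | l < n \<and> l \<le> n - i. sderiv (n - i - l) (?p l)
         / fact (n - i - l) * npoint_term u (take l xs))"
    unfolding sum_distrib_left
  proof (intro sum.cong refl)
    fix l assume "l \<in> {l. l < n \<and> l \<le> n - i}"
    then have "l \<le> n - i" by simp
    then have "(-1) ^ (n - i) = (-1 :: complex) ^ l * (-1) ^ (n - i - l)"
      by (metis le_add_diff_inverse power_add)
    then have "(-1) ^ (n - i) * (-1) ^ (n - i - l) = (-1 :: complex) ^ l"
      by (simp add: mult.assoc flip: power_mult_distrib)
    then show "(deriv ^^ (n - i - l)) h (?p l) / fact (n - i - l)
          * ((-1) ^ l * npoint_term u (take l xs)) =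
        (-1) ^ (n - i) * (sderiv (n - i - l) (?p l) / fact (n - i - l) * npoint_term u (take l xs))"
      by (simp add: sderiv_def mult.assoc[symmetric])
  qed
  finally show ?thesis by (simp add: n_def)
qed

lemma deriv_mat_mult_signed_terms:
  assumes "length xs = Suc n" "\<And>l. 1 \<le> l \<Longrightarrow> l \<le> n \<Longrightarrow> h (\<Sum>x\<leftarrow>take l xs. u x) \<noteq> 0"
  shows "deriv_mat u xs *\<^sub>v signed_terms u xs =
    ((-1) ^ n * npoint_numer_term u xs) \<cdot>\<^sub>v unit_vec (Suc n) 0"
proof (rule eq_vecI)
  fix i assume "i < dim_vec (((-1) ^ n * npoint_numer_term u xs) \<cdot>\<^sub>v unit_vec (Suc n) 0)"
  then have i: "i < Suc n" by simp
  show "(deriv_mat u xs *\<^sub>v signed_terms u xs) $ i =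
      (((-1) ^ n * npoint_numer_term u xs) \<cdot>\<^sub>v unit_vec (Suc n) 0) $ i"
  proof (cases "i = 0")
    case True
    have "{l. l < Suc n \<and> l \<le> Suc n} = {..<Suc n}" by auto
    with True show ?thesis
      using assms(1) by (simp add: deriv_mat_mult_signed_terms_index npoint_numer_term_def
          del: sum.lessThan_Suc)
  next
    case False
    define ys where "ys = take (Suc n - i) xs"
    have ys: "length ys = Suc n - i" "ys \<noteq> []" using assms(1) i by (auto simp: ys_def)
    have "{l. l < length xs \<and> l \<le> length xs - i} = {..length ys}"
      using False i assms(1) ys(1) by auto
    moreover have "take l xs = take l ys" if "l \<le> length ys" for l
      using that ys by (simp add: ys_def min_absorb1)
    moreover have "h (\<Sum>x\<leftarrow>ys. u x) \<noteq> 0" using assms(2)[of "Suc n - i"] False i by (simp add: ys_def)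
    ultimately have "(deriv_mat u xs *\<^sub>v signed_terms u xs) $ i = 0"
      using npoint_term_recursion[OF ys(2)] i assms(1) ys(1)
      by (simp add: deriv_mat_mult_signed_terms_index)
    then show ?thesis using False i by simp
  qed
qed (simp add: deriv_mat_def assms(1))

lemma det_deriv_mat:
  assumes "xs \<noteq> []" "\<And>l. 1 \<le> l \<Longrightarrow> l < length xs \<Longrightarrow> h (\<Sum>x\<leftarrow>take l xs. u x) \<noteq> 0"
  shows "det (deriv_mat u xs) =
    npoint_numer_term u xs * (\<Prod>l\<in>{1..<length xs}. h (\<Sum>x\<leftarrow>take l xs. u x))"
proof -
  obtain n where n: "length xs = Suc n" using assms(1) by (cases xs) auto
  have "det (deriv_mat u xs) =
      (-1) ^ n * ((-1) ^ n * npoint_numer_term u xs) * (\<Prod>i<n. deriv_mat u xs $$ (Suc i, i))"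
  proof (rule det_hessenberg)
    show "signed_terms u xs $ n = 1" by (simp add: signed_terms_def n)
    show "deriv_mat u xs *\<^sub>v signed_terms u xs =
        ((-1) ^ n * npoint_numer_term u xs) \<cdot>\<^sub>v unit_vec (Suc n) 0"
      using n assms(2) by (intro deriv_mat_mult_signed_terms) auto
  qed (auto simp: deriv_mat_def signed_terms_def n)
  also have "(\<Prod>i<n. deriv_mat u xs $$ (Suc i, i)) = (\<Prod>i<n. h (\<Sum>x\<leftarrow>take (n - i) xs. u x))"
    by (intro prod.cong refl) (simp add: deriv_mat_def n)
  also have "\<dots> = (\<Prod>l\<in>{1..<length xs}. h (\<Sum>x\<leftarrow>take l xs. u x))"
    by (rule prod.reindex_bij_witness[of _ "\<lambda>l. n - l" "\<lambda>l. n - l"]) (auto simp: n)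
  finally show ?thesis by (simp flip: mult.assoc power_mult_distrib)
qed

section \<open>Regularity and holomorphic dependence\<close>

definition regular :: "('a \<Rightarrow> complex) \<Rightarrow> 'a set \<Rightarrow> bool" where
  "regular u S \<longleftrightarrow> (\<forall>B. B \<subset> S \<longrightarrow> B \<noteq> {} \<longrightarrow> h (sum u B) \<noteq> 0)"

lemma regularI: "(\<And>B. B \<subset> S \<Longrightarrow> B \<noteq> {} \<Longrightarrow> h (sum u B) \<noteq> 0) \<Longrightarrow> regular u S"
  by (auto simp: regular_def)

lemma regularD: "regular u S \<Longrightarrow> B \<subset> S \<Longrightarrow> B \<noteq> {} \<Longrightarrow> h (sum u B) \<noteq> 0"
  by (auto simp: regular_def)

lemma regular_subset: "regular u S \<Longrightarrow> B \<subseteq> S \<Longrightarrow> regular u B"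
  unfolding regular_def by blast

lemma regular_shift:
  assumes "regular u S" "finite S" "\<And>z. h (z + \<omega>) = 0 \<longleftrightarrow> h z = 0"
  shows "regular (u(a := u a + \<omega>)) S"
proof (rule regularI)
  fix B assume "B \<subset> S" "B \<noteq> {}"
  then show "h (sum (u(a := u a + \<omega>)) B) \<noteq> 0"
    using assms regularD[of u S B] finite_subset[of B S]
    by (simp add: sum_fun_upd_add del: fun_upd_apply)
qed

lemma regular_merge:
  assumes "finite S" "a \<notin> S" "A \<subseteq> S" "regular u (insert a S)"
  shows "regular (u(a := u a + sum u A)) (insert a (S - A))"
proof (rule regularI)
  fix B assume B: "B \<subset> insert a (S - A)" "B \<noteq> {}"
  show "h (sum (u(a := u a + sum u A)) B) \<noteq> 0"
  proof (cases "a \<in> B")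
    case True
    define C where "C = (B - {a}) \<union> A"
    have C: "C \<subset> S" "A \<subseteq> C" "insert a (C - A) = B"
      using B True assms by (auto simp: C_def)
    then have "finite C" "a \<notin> C" using assms by (auto intro: finite_subset)
    with C have "sum (u(a := u a + sum u A)) B = sum u (insert a C)"
      using sum_fun_upd_merge[of C a A u] by simp
    moreover have "insert a C \<subset> insert a S" using C assms by auto
    ultimately show ?thesis using regularD[OF assms(4)] by auto
  next
    case False
    moreover have "B \<subset> insert a S" using B False by auto
    ultimately show ?thesis
      using regularD[OF assms(4)] B by (simp add: sum_fun_upd_notin del: fun_upd_apply)
  qed
qed

lemma npoint_holomorphic:
  assumes "finite S" "\<And>i. i \<in> S \<Longrightarrow> (\<lambda>z. U z i) holomorphic_on A"
    and "\<And>z B. z \<in> A \<Longrightarrow> B \<subseteq> S \<Longrightarrow> B \<noteq> {} \<Longrightarrow> h (sum (U z) B) \<noteq> 0"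
  shows "(\<lambda>z. npoint (U z) S) holomorphic_on A"
  using assms
proof (induction S rule: finite_psubset_induct)
  case (psubset S)
  show ?case
  proof (cases "S = {}")
    case False
    have "(\<lambda>z. npoint_numer (U z) S / h (sum (U z) S)) holomorphic_on A"
      unfolding npoint_numer_def
    proof (intro holomorphic_intros)
      fix B assume "B \<in> {B. B \<subset> S}"
      then show "(\<lambda>z. npoint (U z) B) holomorphic_on A"
        using psubset.prems by (intro psubset.IH) auto
    qed (use psubset.prems False in auto)
    then show ?thesis using psubset.hyps False by (simp add: npoint_eq)
  qed simp
qed

lemma npoint_numer_holomorphic:
  assumes "finite S" "\<And>i. i \<in> S \<Longrightarrow> (\<lambda>z. U z i) holomorphic_on A"
    and "\<And>z. z \<in> A \<Longrightarrow> regular (U z) S"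
  shows "(\<lambda>z. npoint_numer (U z) S) holomorphic_on A"
  unfolding npoint_numer_def
proof (intro holomorphic_intros npoint_holomorphic)
  fix z B C assume "z \<in> A" "B \<in> {B. B \<subset> S}" "C \<subseteq> B" "C \<noteq> {}"
  then show "h (sum (U z) C) \<noteq> 0" using regularD[OF assms(3)] by blast
qed (use assms in \<open>auto intro: finite_subset\<close>)

lemma isCont_sderiv_sum:
  assumes "\<And>i. i \<in> S \<Longrightarrow> (\<lambda>z. U z i) holomorphic_on UNIV"
  shows "isCont (\<lambda>z. sderiv k (sum (U z) S)) z0"
proof -
  have "(\<lambda>z. sderiv k (sum (U z) S)) holomorphic_on UNIV" using assms by (intro holomorphic_intros)
  then show ?thesis
    using holomorphic_on_imp_continuous_on continuous_on_eq_continuous_at by blast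
qed

lemma isCont_h_sum:
  assumes "\<And>i. i \<in> S \<Longrightarrow> (\<lambda>z. U z i) holomorphic_on UNIV"
  shows "isCont (\<lambda>z. h (sum (U z) S)) z0"
  using isCont_sderiv_sum[where k = 0, OF assms] by (simp add: sderiv_0)

lemma open_regular:
  assumes "finite S" "\<And>i. i \<in> S \<Longrightarrow> (\<lambda>z. U z i) holomorphic_on UNIV"
  shows "open {z. regular (U z) S}"
proof -
  have "{z. regular (U z) S} = (\<Inter>B\<in>{B. B \<subset> S \<and> B \<noteq> {}}. {z. h (sum (U z) B) \<noteq> 0})"
    by (auto simp: regular_def)
  moreover have "open {z. h (sum (U z) B) \<noteq> 0}" if "B \<subset> S" for B
  proof -
    have "continuous_on UNIV (\<lambda>z. h (sum (U z) B))"
      using that assms(2) isCont_h_sum[of B U]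
      by (intro continuous_at_imp_continuous_on) auto
    then show ?thesis by (intro open_Collect_neq) auto
  qed
  moreover have "finite {B. B \<subset> S \<and> B \<noteq> {}}"
    by (rule finite_subset[of _ "{B. B \<subset> S}"]) (use assms(1) in auto)
  ultimately show ?thesis by (simp add: open_INT)
qed

lemma npoint_numer_holomorphic_regular:
  assumes "finite S" "\<And>i. i \<in> S \<Longrightarrow> (\<lambda>z. U z i) holomorphic_on UNIV"
  shows "(\<lambda>z. npoint_numer (U z) S) holomorphic_on {z. regular (U z) S}"
  using assms(1) holomorphic_on_subset[OF assms(2) subset_UNIV]
  by (rule npoint_numer_holomorphic) simp_all

lemma npoint_numer_analytic_at:
  assumes "finite S" "\<And>i. i \<in> S \<Longrightarrow> (\<lambda>z. U z i) holomorphic_on UNIV" "regular (U z0) S"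
  shows "(\<lambda>z. npoint_numer (U z) S) analytic_on {z0}"
  using open_regular[OF assms(1,2)] npoint_numer_holomorphic_regular[OF assms(1,2)] assms(3)
  unfolding analytic_at by (intro exI[of _ "{z. regular (U z) S}"]) simp

lemma isCont_npoint_numer:
  assumes "finite S" "\<And>i. i \<in> S \<Longrightarrow> (\<lambda>z. U z i) holomorphic_on UNIV" "regular (U z0) S"
  shows "isCont (\<lambda>z. npoint_numer (U z) S) z0"
  using npoint_numer_analytic_at[OF assms] by (rule analytic_at_imp_isCont)

lemma isCont_npoint:
  assumes "finite S" "\<And>i. i \<in> S \<Longrightarrow> (\<lambda>z. U z i) holomorphic_on UNIV" "regular (U z0) S"
    "S = {} \<or> h (sum (U z0) S) \<noteq> 0"
  shows "isCont (\<lambda>z. npoint (U z) S) z0"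
proof (cases "S = {}")
  case False
  have "isCont (\<lambda>z. npoint_numer (U z) S / h (sum (U z) S)) z0"
    using assms False
    by (intro continuous_divide isCont_npoint_numer isCont_h_sum) auto
  then show ?thesis using assms False by (simp add: npoint_eq)
qed simp

section \<open>Quasi-periodicity on the hyperplanes\<close>

lemma sderiv_shift_multiplier:
  assumes "\<And>z. h (z + \<omega>) = s * h z"
  shows "sderiv k (z + \<omega>) = s * sderiv k z"
proof (induction k arbitrary: z)
  case (Suc k)
  have "((\<lambda>z. sderiv k (z + \<omega>)) has_field_derivative - sderiv (Suc k) (z + \<omega>)) (at z)"
    using sderiv_has_field_derivative[of k "z + \<omega>"] by (simp only: DERIV_shift)
  moreover have "((\<lambda>z. s * sderiv k z) has_field_derivative s * - sderiv (Suc k) z) (at z)"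
    by (intro DERIV_cmult sderiv_has_field_derivative)
  ultimately have "- sderiv (Suc k) (z + \<omega>) = s * - sderiv (Suc k) z"
    unfolding Suc.IH by (rule DERIV_unique)
  then show ?case by simp
qed (simp add: sderiv_0 assms)

lemma npoint_shift_multiplier:
  assumes h: "\<And>z. h (z + \<omega>) = s * h z" and "s \<noteq> 0" and "finite S"
  shows "npoint (u(a := u a + \<omega>)) S = (if a \<in> S then npoint u S / s else npoint u S)"
    and "npoint_numer (u(a := u a + \<omega>)) S = npoint_numer u S"
proof -
  let ?v = "u(a := u a + \<omega>)"
  have numer: "npoint_numer ?v S = npoint_numer u S"
    if "finite S"
      "\<And>B. B \<subset> S \<Longrightarrow> npoint ?v B = (if a \<in> B then npoint u B / s else npoint u B)" for S
    unfolding npoint_numer_def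
  proof (intro arg_cong[where f = uminus] sum.cong refl)
    fix B assume B: "B \<in> {B. B \<subset> S}"
    then have "finite B" using that(1) by (auto intro: finite_subset)
    then show "sderiv (card (S - B)) (sum ?v B) * npoint ?v B =
        sderiv (card (S - B)) (sum u B) * npoint u B"
      using B that(2)[of B] \<open>s \<noteq> 0\<close>
      by (simp add: sum_fun_upd_add sderiv_shift_multiplier[OF h] del: fun_upd_apply)
  qed
  have npoint: "npoint ?v S = (if a \<in> S then npoint u S / s else npoint u S)" if "finite S" for S
    using that
  proof (induction S rule: finite_psubset_induct)
    case (psubset S)
    then show ?case
      using numer[OF psubset.hyps psubset.IH]
      by (cases "S = {}") (simp_all add: npoint_eq sum_fun_upd_add h mult.commute del: fun_upd_apply)
  qed
  show "npoint ?v S = (if a \<in> S then npoint u S / s else npoint u S)"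
    using \<open>finite S\<close> by (rule npoint)
  show "npoint_numer ?v S = npoint_numer u S"
    using \<open>finite S\<close> by (intro numer npoint) (auto intro: finite_subset)
qed

lemma npoint_numer_shift_2pi_i:
  assumes "finite S"
  shows "npoint_numer (u(a := u a + of_int k * (2 * pi * \<i>))) S = npoint_numer u S"
proof -
  interpret periodic_fun_simple "\<lambda>x. npoint_numer (u(a := x)) S" "2 * pi * \<i>"
  proof
    fix x
    show "npoint_numer (u(a := x + 2 * pi * \<i>)) S = npoint_numer (u(a := x)) S"
      using npoint_shift_multiplier(2)[of "2 * pi * \<i>" "- 1" S "u(a := x)" a] antiperiod assms
      by simp
  qed
  show ?thesis using plus_of_int[of "u a" k] by simp
qed

lemma h_shift_2pi_i_eq_0_iff: "h (z + of_int k * (2 * pi * \<i>)) = 0 \<longleftrightarrow> h z = 0"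
proof -
  interpret periodic_fun_simple "\<lambda>z. h z = 0" "2 * pi * \<i>"
    by standard (simp only: antiperiod neg_equal_0_iff_equal)
  show ?thesis by (rule plus_of_int)
qed

definition vanishing_below :: "'a set \<Rightarrow> bool" where
  "vanishing_below S \<longleftrightarrow>
     (\<forall>u R. R \<subset> S \<longrightarrow> 2 \<le> card R \<longrightarrow> sum u R = 0 \<longrightarrow> regular u R \<longrightarrow> npoint_numer u R = 0)"

definition one_below :: "'a set \<Rightarrow> bool" where
  "one_below S \<longleftrightarrow>
     (\<forall>u R. R \<subset> S \<longrightarrow> R \<noteq> {} \<longrightarrow> sum u R = - \<tau> \<longrightarrow> regular u R \<longrightarrow> npoint_numer u R = 1)"

lemma vanishing_belowD:
  "vanishing_below S \<Longrightarrow> R \<subset> S \<Longrightarrow> 2 \<le> card R \<Longrightarrow> sum u R = 0 \<Longrightarrow> regular u R \<Longrightarrow> npoint_numer u R = 0"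
  by (auto simp: vanishing_below_def)

lemma npoint_numer_merge_below:
  assumes one: "one_below (insert a S)" and "finite S" "a \<notin> S" "A \<subseteq> S" "A \<noteq> {}"
    and u: "sum u (insert a S) = - \<tau>" "regular u (insert a S)"
  shows "npoint_numer (u(a := u a + sum u A)) (insert a (S - A)) = 1"
proof -
  have "insert a (S - A) \<subset> insert a S" using assms(3-5) by auto
  moreover have "sum (u(a := u a + sum u A)) (insert a (S - A)) = - \<tau>"
    using sum_fun_upd_merge[of S a A u] assms by simp
  moreover have "regular (u(a := u a + sum u A)) (insert a (S - A))"
    using assms by (intro regular_merge)
  ultimately show ?thesis using one unfolding one_below_def by blast
qed

lemma npoint_numer_add_tau_hyperplane:
  assumes one: "one_below S" and S: "finite S" "2 \<le> card S" and a: "a \<in> S"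
    and u: "sum u S = - \<tau>" "regular u S"
  shows "npoint_numer (u(a := u a + \<tau>)) S = npoint_numer u S - 1"
proof -
  define R where "R = S - {a}"
  have R: "S = insert a R" "a \<notin> R" "finite R" using a S by (auto simp: R_def)
  then have "R \<noteq> {}" using S by auto
  have "h (u a + sum u B) \<noteq> 0" if "B \<subset> R" for B
  proof -
    have "a \<notin> B" "finite B" "insert a B \<subset> S" using that R by (auto intro: finite_subset)
    then show ?thesis using regularD[OF u(2), of "insert a B"] by simp
  qed
  then have "npoint_numer (u(a := u a + \<tau>)) S =
      (\<Sum>A\<in>Pow R. (-1) ^ card A * npoint_numer (u(a := u a + sum u A)) (insert a (R - A)))"
    unfolding R(1) using R by (intro npoint_numer_add_tau) auto
  also have "\<dots> = (\<Sum>A\<in>Pow R. (-1) ^ card A + (if A = {} then npoint_numer u S - 1 else 0))"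
  proof (intro sum.cong refl)
    fix A assume "A \<in> Pow R"
    then show "(-1) ^ card A * npoint_numer (u(a := u a + sum u A)) (insert a (R - A)) =
        (-1) ^ card A + (if A = {} then npoint_numer u S - 1 else 0)"
      using npoint_numer_merge_below[of a R A u] one u R
      by (cases "A = {}") (simp_all del: fun_upd_apply)
  qed
  also have "\<dots> = npoint_numer u S - 1"
    using sum_Pow_minus_one_power_card[of R, where ?'a = complex] R \<open>R \<noteq> {}\<close>
    by (simp add: sum.distrib)
  finally show ?thesis .
qed

lemma vanishing_below_imp_one_below:
  assumes "finite S" "vanishing_below S"
  shows "one_below S"
proof -
  have "npoint_numer u R = 1"
    if "finite R" "R \<subset> S" "R \<noteq> {}" "sum u R = - \<tau>" "regular u R" for u R
    using that
  proof (induction R arbitrary: u rule: finite_psubset_induct)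
    case (psubset R)
    show ?case
    proof (cases "card R = 1")
      case True
      then show ?thesis by (auto simp: card_1_singleton_iff)
    next
      case False
      moreover have "card R \<noteq> 0" using psubset.hyps psubset.prems(2) by simp
      ultimately have R: "2 \<le> card R" by linarith
      obtain a where a: "a \<in> R" using psubset.prems by blast
      have "one_below R" unfolding one_below_def using psubset.IH psubset.prems by blast
      then have "npoint_numer (u(a := u a + \<tau>)) R = npoint_numer u R - 1"
        using psubset.hyps psubset.prems R a by (intro npoint_numer_add_tau_hyperplane)
      moreover have "npoint_numer (u(a := u a + \<tau>)) R = 0"
      proof (rule vanishing_belowD[OF assms(2)])
        show "sum (u(a := u a + \<tau>)) R = 0"
          using psubset a sum_fun_upd_add[of R u a \<tau>] by simp
        show "regular (u(a := u a + \<tau>)) R"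
          using psubset h_tau_eq_0_iff by (intro regular_shift)
      qed (use psubset.prems R in auto)
      ultimately show ?thesis by simp
    qed
  qed
  then show ?thesis
    unfolding one_below_def using assms(1) by (meson finite_subset psubset_imp_subset)
qed

lemma npoint_numer_opposite_shifts:
  assumes van: "vanishing_below S" and S: "finite S" and ab: "a \<in> S" "b \<in> S" "a \<noteq> b"
    and u: "sum u S = 0" "regular u S"
  shows "npoint_numer (u(a := u a + \<tau>, b := u b - \<tau>)) S = npoint_numer u S"
proof -
  define v where "v = u(b := u b - \<tau>)"
  have "regular (u(b := u b + - \<tau>)) S"
    using u(2) S h_tau_eq_0_iff[of "z - \<tau>" for z] by (intro regular_shift) auto
  then have v: "regular v S" "sum v S = - \<tau>"
    using sum_fun_upd_add[OF S, of u b "- \<tau>"] u(1) ab by (simp_all add: v_def)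
  have "card {a, b} \<le> card S" using S ab by (intro card_mono) auto
  then have "2 \<le> card S" using ab by simp
  then have step: "npoint_numer (v(i := v i + \<tau>)) S = npoint_numer v S - 1" if "i \<in> S" for i
    using that S v van by (intro npoint_numer_add_tau_hyperplane vanishing_below_imp_one_below)
  have "v(b := v b + \<tau>) = u" "v(a := v a + \<tau>) = u(a := u a + \<tau>, b := u b - \<tau>)"
    using ab by (auto simp: v_def)
  then show ?thesis using step[OF ab(1)] step[OF ab(2)] by simp
qed

end

section \<open>Behaviour at the poles\<close>

lemma even_deriv_at_0_eq_0:
  fixes g :: "complex \<Rightarrow> complex"
  assumes "(g has_field_derivative d) (at 0)" "\<And>z. g (- z) = g z"
  shows "d = 0"
proof -
  have "((\<lambda>z. g (- z)) has_field_derivative d * (- 1)) (at 0)"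
    using assms(1) by (intro DERIV_chain2[of g]) (auto intro!: derivative_eq_intros)
  then have "d * (- 1) = d" using assms by (simp add: DERIV_unique)
  then show "d = 0" by simp
qed

lemma odd_over_square_tendsto_0:
  assumes "f holomorphic_on UNIV" "\<And>z. f (- z) = - f z" "deriv f 0 = 0"
  shows "((\<lambda>z. f z / z ^ 2) \<longlongrightarrow> 0) (at 0)"
proof -
  have "f 0 = 0" using assms(2)[of 0] by simp
  define g where "g = (\<lambda>z. if z = 0 then deriv f 0 else (f z - f 0) / (z - 0))"
  have "g holomorphic_on UNIV"
    unfolding g_def using assms(1) by (rule pole_lemma_open) simp
  then have deriv: "(g has_field_derivative deriv g 0) (at 0)" by (intro holomorphic_derivI) auto
  moreover have "g (- z) = g z" for z using assms(2) \<open>f 0 = 0\<close> by (simp add: g_def)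
  ultimately have "deriv g 0 = 0" by (rule even_deriv_at_0_eq_0)
  then have "((\<lambda>z. (g z - g 0) / (z - 0)) \<longlongrightarrow> 0) (at 0)"
    using deriv by (simp add: has_field_derivative_iff)
  then show ?thesis
    by (rule Lim_transform_eventually)
      (auto simp: eventually_at_filter g_def assms(3) \<open>f 0 = 0\<close> power2_eq_square)
qed

context theta_like
begin

lemma z_over_h_tendsto_1: "((\<lambda>z. z / h z) \<longlongrightarrow> 1) (at 0)"
  using h_has_field_derivative[of 0]
  by (intro lhopital_complex_simple[OF DERIV_ident]) (auto simp: deriv_at_0)

lemma h_eventually_nonzero: "eventually (\<lambda>z. h z \<noteq> 0) (at 0)"
  using tendsto_imp_eventually_ne[OF z_over_h_tendsto_1, of 0] by (rule eventually_mono) auto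

lemma h_affine_eventually_nonzero:
  assumes "m \<noteq> 0"
  shows "eventually (\<lambda>z. h (y + z * m) \<noteq> 0) (at p)"
proof -
  obtain w where "h w \<noteq> 0"
    using eventually_happens[OF h_eventually_nonzero] by auto
  then have "eventually (\<lambda>z. h (y + z * m) \<noteq> 0 \<and> z \<in> UNIV) (at p)"
    using assms by (intro non_zero_neighbour_alt[where \<beta> = "(w - y) / m"] holomorphic_intros) auto
  then show ?thesis by simp
qed

lemma deriv_h_affine_at_zero:
  assumes "\<And>z. x z = m * (z - z0)"
  shows "deriv (\<lambda>z. h (x z)) z0 = m"
proof -
  have "x z0 = 0" by (simp add: assms)
  have "(x has_field_derivative m) (at z0)"
    unfolding assms by (auto intro!: derivative_eq_intros)
  then have "((\<lambda>z. h (x z)) has_field_derivative deriv h (x z0) * m) (at z0)"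
    by (intro DERIV_chain2[OF h_has_field_derivative])
  then show ?thesis by (simp add: DERIV_imp_deriv \<open>x z0 = 0\<close> deriv_at_0)
qed

lemma deriv_h_even: "deriv h (- z) = deriv h z"
proof -
  have "((\<lambda>z. h (- z)) has_field_derivative deriv h (- z) * (- 1)) (at z)"
    by (intro DERIV_chain2[of h] h_has_field_derivative) (auto intro!: derivative_eq_intros)
  moreover have "((\<lambda>z. - h z) has_field_derivative - deriv h z) (at z)"
    by (intro DERIV_minus h_has_field_derivative)
  ultimately have "deriv h (- z) * (- 1) = - deriv h z"
    unfolding odd by (rule DERIV_unique)
  then show ?thesis by simp
qed

lemma odd_over_z_h_tendsto_0:
  assumes "f holomorphic_on UNIV" "\<And>z. f (- z) = - f z" "deriv f 0 = 0"
  shows "((\<lambda>z. f z / (z * h z)) \<longlongrightarrow> 0) (at 0)"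
proof -
  have "((\<lambda>z. f z / z ^ 2 * (z / h z)) \<longlongrightarrow> 0 * 1) (at 0)"
    by (intro tendsto_mult odd_over_square_tendsto_0 z_over_h_tendsto_1 assms)
  moreover have "(\<lambda>z. f z / z ^ 2 * (z / h z)) = (\<lambda>z. f z / (z * h z))"
    by (auto simp: fun_eq_iff power2_eq_square)
  ultimately show ?thesis by simp
qed

lemma inverse_h_pole: "((\<lambda>z. 1 / h z - 1 / z) \<longlongrightarrow> 0) (at 0)"
proof -
  have "((\<lambda>z. (z - h z) / (z * h z)) \<longlongrightarrow> 0) (at 0)"
  proof (rule odd_over_z_h_tendsto_0)
    show "(\<lambda>z. z - h z) holomorphic_on UNIV" by (intro holomorphic_intros)
    have "((\<lambda>z. z - h z) has_field_derivative 1 - deriv h 0) (at 0)"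
      by (intro DERIV_diff DERIV_ident h_has_field_derivative)
    then show "deriv (\<lambda>z. z - h z) 0 = 0" by (simp add: DERIV_imp_deriv deriv_at_0)
  qed (simp add: odd)
  moreover have "eventually (\<lambda>z. (z - h z) / (z * h z) = 1 / h z - 1 / z) (at 0)"
    using h_eventually_nonzero eventually_neq_at_within[of 0]
    by eventually_elim (simp add: field_simps)
  ultimately show ?thesis by (rule Lim_transform_eventually)
qed

lemma log_deriv_h_pole: "((\<lambda>z. 1 / z - deriv h z / h z) \<longlongrightarrow> 0) (at 0)"
proof -
  have deriv_h: "(deriv h has_field_derivative deriv (deriv h) z) (at z)" for z
    using has_field_derivative_higher_deriv[OF holomorphic, of z 1] by simp
  have "((\<lambda>z. (h z - z * deriv h z) / (z * h z)) \<longlongrightarrow> 0) (at 0)"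
  proof (rule odd_over_z_h_tendsto_0)
    show "(\<lambda>z. h z - z * deriv h z) holomorphic_on UNIV"
      using holomorphic by (intro holomorphic_intros) auto
    have "((\<lambda>z. h z - z * deriv h z) has_field_derivative
        deriv h 0 - (1 * deriv h 0 + deriv (deriv h) 0 * 0)) (at 0)"
      by (intro DERIV_diff DERIV_mult DERIV_ident h_has_field_derivative deriv_h)
    then show "deriv (\<lambda>z. h z - z * deriv h z) 0 = 0" by (simp add: DERIV_imp_deriv)
  qed (simp add: odd deriv_h_even)
  moreover have "eventually (\<lambda>z. (h z - z * deriv h z) / (z * h z) = 1 / z - deriv h z / h z) (at 0)"
    using h_eventually_nonzero eventually_neq_at_within[of 0]
    by eventually_elim (simp add: field_simps)
  ultimately show ?thesis by (rule Lim_transform_eventually)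
qed

definition slope_defect :: "nat \<Rightarrow> complex \<Rightarrow> complex \<Rightarrow> complex" where
  "slope_defect k x z = (sderiv k (x + z) - sderiv k x) / z + sderiv (Suc k) x"

lemma slope_defect_tendsto_0:
  assumes x: "(x has_field_derivative d) (at 0)"
  shows "((\<lambda>z. slope_defect k (x z) z) \<longlongrightarrow> 0) (at 0)"
proof -
  have "((\<lambda>z. sderiv k (x z + z) - sderiv k (x z)) has_field_derivative
      - sderiv (Suc k) (x 0 + 0) * (d + 1) - (- sderiv (Suc k) (x 0) * d)) (at 0)"
    by (intro DERIV_diff DERIV_add DERIV_ident x DERIV_chain2[OF sderiv_has_field_derivative])
  then have "((\<lambda>z. (sderiv k (x z + z) - sderiv k (x z)) / z) \<longlongrightarrow> - sderiv (Suc k) (x 0)) (at 0)"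
    by (simp add: has_field_derivative_iff algebra_simps)
  moreover have "((\<lambda>z. sderiv (Suc k) (x z)) \<longlongrightarrow> sderiv (Suc k) (x 0)) (at 0)"
    using isCont_o2[OF DERIV_isCont[OF x] isCont_sderiv] by (simp add: isCont_def)
  ultimately have "((\<lambda>z. slope_defect k (x z) z) \<longlongrightarrow>
      - sderiv (Suc k) (x 0) + sderiv (Suc k) (x 0)) (at 0)"
    unfolding slope_defect_def by (rule tendsto_add)
  then show ?thesis by simp
qed

definition insertion_defect :: "('a \<Rightarrow> complex) \<Rightarrow> 'a \<Rightarrow> 'a set \<Rightarrow> complex" where
  "insertion_defect u a D =
     npoint_numer u (insert a D) - npoint_numer u D / u a - deriv h (sum u D) * npoint u D"

lemma insertion_defect_expansion:
  assumes "finite D" "a \<notin> D" "u a \<noteq> 0"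
  shows "insertion_defect u a D = - (\<Sum>B | B \<subset> D.
    sderiv (card (D - B)) (sum u B + u a) * (npoint u (insert a B) - npoint u B / u a)
      + slope_defect (card (D - B)) (sum u B) (u a) * npoint u B)"
proof -
  let ?k = "\<lambda>B. card (D - B)"
  have "(\<Sum>B | B \<subset> D. sderiv (?k B) (sum u B + u a) * (npoint u (insert a B) - npoint u B / u a)
         + slope_defect (?k B) (sum u B) (u a) * npoint u B) =
      (\<Sum>B | B \<subset> D. sderiv (?k B) (u a + sum u B) * npoint u (insert a B)
         + sderiv (Suc (?k B)) (sum u B) * npoint u B - sderiv (?k B) (sum u B) * npoint u B / u a)"
    using assms(3) by (intro sum.cong refl) (simp add: slope_defect_def field_simps)
  also have "\<dots> = (\<Sum>B | B \<subset> D. sderiv (?k B) (u a + sum u B) * npoint u (insert a B))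
      + (npoint_sum_Suc u D + deriv h (sum u D) * npoint u D) + npoint_numer u D / u a"
    using assms(1)
    by (simp add: sum.distrib sum_subtractf npoint_sum_Suc_def sum_Pow_proper npoint_numer_def
        sum_divide_distrib sderiv_1)
  finally show ?thesis
    by (simp add: insertion_defect_def npoint_numer_insert[OF assms(1,2)])
qed

lemma npoint_insert_minus_pole:
  assumes "finite D" "D \<noteq> {}" "a \<notin> D"
    and "u a \<noteq> 0" "h (sum u D) \<noteq> 0" "h (sum u D + u a) \<noteq> 0"
  shows "npoint u (insert a D) - npoint u D / u a =
    (insertion_defect u a D - slope_defect 0 (sum u D) (u a) * npoint u D) / h (sum u D + u a)"
proof -
  have numer: "npoint_numer u D = h (sum u D) * npoint u D"
    using assms by (simp add: npoint_eq)
  have "npoint u (insert a D) = npoint_numer u (insert a D) / h (sum u D + u a)"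
    using assms(1,3) by (simp add: npoint_eq add.commute)
  then show ?thesis
    using assms(4-6)
    by (simp add: insertion_defect_def slope_defect_def sderiv_0 sderiv_1 numer field_simps)
qed

lemma sum_has_field_derivative_holomorphic:
  assumes "\<And>i. i \<in> B \<Longrightarrow> (\<lambda>z. U z i) holomorphic_on UNIV"
  shows "((\<lambda>z. sum (U z) B) has_field_derivative deriv (\<lambda>z. sum (U z) B) z0) (at z0)"
proof -
  have "(\<lambda>z. sum (U z) B) holomorphic_on UNIV" using assms by (intro holomorphic_intros)
  then show ?thesis by (intro holomorphic_derivI) auto
qed

lemma sderiv_sum_add_tendsto:
  assumes "\<And>i. i \<in> B \<Longrightarrow> (\<lambda>z. U z i) holomorphic_on UNIV"
  shows "((\<lambda>z. sderiv k (sum (U z) B + z)) \<longlongrightarrow> sderiv k (sum (U 0) B)) (at 0)"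
proof -
  have "isCont (\<lambda>z. sderiv k (sum (U z) B + z)) 0"
    by (intro isCont_o2[OF _ isCont_sderiv] continuous_intros
        DERIV_isCont[OF sum_has_field_derivative_holomorphic[OF assms]])
  then show ?thesis by (simp add: isCont_def)
qed

lemma insertion_defect_tendsto_0:
  assumes D: "finite D" "a \<notin> D" and Ua: "\<And>z. U z a = z"
    and U: "\<And>i. i \<in> D \<Longrightarrow> (\<lambda>z. U z i) holomorphic_on UNIV"
    and reg: "regular (U 0) D"
    and pole: "\<And>B. B \<subset> D \<Longrightarrow> ((\<lambda>z. npoint (U z) (insert a B) - npoint (U z) B / z) \<longlongrightarrow> 0) (at 0)"
  shows "((\<lambda>z. insertion_defect (U z) a D) \<longlongrightarrow> 0) (at 0)"
proof -
  let ?summand = "\<lambda>z B. sderiv (card (D - B)) (sum (U z) B + z)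
        * (npoint (U z) (insert a B) - npoint (U z) B / z)
      + slope_defect (card (D - B)) (sum (U z) B) z * npoint (U z) B"
  have "((\<lambda>z. ?summand z B) \<longlongrightarrow> 0) (at 0)" if B: "B \<subset> D" for B
  proof -
    have U_B: "(\<lambda>z. U z i) holomorphic_on UNIV" if "i \<in> B" for i using B U that by blast
    have "regular (U 0) B" "B = {} \<or> h (sum (U 0) B) \<noteq> 0"
      using B regular_subset[OF reg] regularD[OF reg] by blast+
    then have "isCont (\<lambda>z. npoint (U z) B) 0"
      using B D U_B by (intro isCont_npoint) (auto intro: finite_subset)
    then have "((\<lambda>z. ?summand z B) \<longlongrightarrow> sderiv (card (D - B)) (sum (U 0) B) * 0
        + 0 * npoint (U 0) B) (at 0)"
      by (intro tendsto_add tendsto_mult pole B sderiv_sum_add_tendsto U_B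
          slope_defect_tendsto_0[OF sum_has_field_derivative_holomorphic]) (simp_all add: isCont_def)
    then show ?thesis by simp
  qed
  then have "((\<lambda>z. - (\<Sum>B | B \<subset> D. ?summand z B)) \<longlongrightarrow> - (\<Sum>B | B \<subset> D. 0)) (at 0)"
    by (intro tendsto_minus tendsto_sum) auto
  then have "((\<lambda>z. - (\<Sum>B | B \<subset> D. ?summand z B)) \<longlongrightarrow> 0) (at 0)" by simp
  moreover have "eventually (\<lambda>z. - (\<Sum>B | B \<subset> D. ?summand z B) = insertion_defect (U z) a D) (at 0)"
    using eventually_neq_at_within[of 0]
    by eventually_elim (simp add: insertion_defect_expansion[OF D] Ua)
  ultimately show ?thesis by (rule Lim_transform_eventually)
qed

lemma npoint_insert_pole_step:
  assumes D: "finite D" "D \<noteq> {}" "a \<notin> D" and Ua: "\<And>z. U z a = z"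
    and U: "\<And>i. i \<in> D \<Longrightarrow> (\<lambda>z. U z i) holomorphic_on UNIV"
    and reg: "regular (U 0) D" and h_D: "h (sum (U 0) D) \<noteq> 0"
    and defect: "((\<lambda>z. insertion_defect (U z) a D) \<longlongrightarrow> 0) (at 0)"
  shows "((\<lambda>z. npoint (U z) (insert a D) - npoint (U z) D / z) \<longlongrightarrow> 0) (at 0)"
proof -
  let ?x = "\<lambda>z. sum (U z) D"
  have h_add: "((\<lambda>z. h (?x z + z)) \<longlongrightarrow> h (?x 0)) (at 0)"
    using sderiv_sum_add_tendsto[where k = 0, OF U] by (simp add: sderiv_0)
  have "isCont (\<lambda>z. npoint (U z) D) 0" using D U reg h_D by (intro isCont_npoint) auto
  then have "((\<lambda>z. (insertion_defect (U z) a D - slope_defect 0 (?x z) z * npoint (U z) D)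
      / h (?x z + z))
      \<longlongrightarrow> (0 - 0 * npoint (U 0) D) / h (?x 0)) (at 0)"
    using h_D U
    by (intro tendsto_divide tendsto_diff tendsto_mult defect h_add
        slope_defect_tendsto_0[OF sum_has_field_derivative_holomorphic]) (auto simp: isCont_def)
  then have "((\<lambda>z. (insertion_defect (U z) a D - slope_defect 0 (?x z) z * npoint (U z) D)
      / h (?x z + z))
      \<longlongrightarrow> 0) (at 0)" by simp
  moreover have "((\<lambda>z. h (?x z)) \<longlongrightarrow> h (?x 0)) (at 0)"
    using isCont_h_sum[OF U] by (simp add: isCont_def)
  then have "eventually (\<lambda>z. h (?x z) \<noteq> 0) (at 0)" "eventually (\<lambda>z. h (?x z + z) \<noteq> 0) (at 0)"
    using h_D h_add by (auto dest: tendsto_imp_eventually_ne)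
  then have "eventually (\<lambda>z. (insertion_defect (U z) a D - slope_defect 0 (?x z) z * npoint (U z) D)
      / h (?x z + z) = npoint (U z) (insert a D) - npoint (U z) D / z) (at 0)"
    using eventually_neq_at_within[of 0]
  proof eventually_elim
    case (elim z)
    then show ?case using npoint_insert_minus_pole[OF D, of "U z"] by (simp add: Ua)
  qed
  ultimately show ?thesis by (rule Lim_transform_eventually)
qed

lemma npoint_insert_pole:
  assumes "finite D" "a \<notin> D" and Ua: "\<And>z. U z a = z"
    and "\<And>i. i \<in> D \<Longrightarrow> (\<lambda>z. U z i) holomorphic_on UNIV"
    and "\<And>B. B \<subseteq> D \<Longrightarrow> B \<noteq> {} \<Longrightarrow> h (sum (U 0) B) \<noteq> 0"
  shows "((\<lambda>z. npoint (U z) (insert a D) - npoint (U z) D / z) \<longlongrightarrow> 0) (at 0)"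
  using assms(1,2,4,5)
proof (induction D rule: finite_psubset_induct)
  case (psubset D)
  show ?case
  proof (cases "D = {}")
    case True
    then show ?thesis using inverse_h_pole by (simp add: npoint_eq Ua)
  next
    case False
    have regular: "regular (U 0) D"
      using psubset.prems(3) by (intro regularI) blast
    moreover have "((\<lambda>z. insertion_defect (U z) a D) \<longlongrightarrow> 0) (at 0)"
      using psubset.hyps psubset.prems regular
      by (intro insertion_defect_tendsto_0 Ua psubset.IH) auto
    ultimately show ?thesis
      using psubset.hyps psubset.prems False by (intro npoint_insert_pole_step Ua) auto
  qed
qed

lemma npoint_numer_hyperplane_tendsto_0:
  assumes S: "finite S" "a \<notin> S" and Ua: "\<And>z. U z a = z"
    and U: "\<And>i. i \<in> S \<Longrightarrow> (\<lambda>z. U z i) holomorphic_on UNIV"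
    and sum_S: "\<And>z. sum (U z) S = - z"
    and regular: "regular (U 0) S"
  shows "((\<lambda>z. npoint_numer (U z) (insert a S)) \<longlongrightarrow> 0) (at 0)"
proof -
  have "S \<noteq> {}" using sum_S[of 1] by auto
  have "((\<lambda>z. insertion_defect (U z) a S) \<longlongrightarrow> 0) (at 0)"
  proof (rule insertion_defect_tendsto_0[OF S Ua U regular])
    fix B assume "B \<subset> S"
    then show "((\<lambda>z. npoint (U z) (insert a B) - npoint (U z) B / z) \<longlongrightarrow> 0) (at 0)"
      using S U regularD[OF regular] by (intro npoint_insert_pole Ua) (auto intro: finite_subset)
  qed auto
  moreover have "((\<lambda>z. npoint_numer (U z) S) \<longlongrightarrow> npoint_numer (U 0) S) (at 0)"
    using isCont_npoint_numer[OF S(1) U regular] by (simp add: isCont_def)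
  ultimately have "((\<lambda>z. insertion_defect (U z) a S
      + npoint_numer (U z) S * (1 / z - deriv h z / h z)) \<longlongrightarrow> 0 + npoint_numer (U 0) S * 0) (at 0)"
    by (intro tendsto_add tendsto_mult log_deriv_h_pole)
  moreover have "insertion_defect (U z) a S + npoint_numer (U z) S * (1 / z - deriv h z / h z) =
      npoint_numer (U z) (insert a S)" for z
    using S \<open>S \<noteq> {}\<close>
    by (simp add: insertion_defect_def Ua npoint_eq sum_S deriv_h_even odd algebra_simps)
  ultimately show ?thesis by simp
qed

lemma npoint_bigo_simple_zero:
  assumes "finite S" "S \<noteq> {}" and U: "\<And>i. i \<in> S \<Longrightarrow> (\<lambda>z. U z i) holomorphic_on UNIV"
    and "regular (U z0) S" "npoint_numer (U z0) S = 0"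
    and "h (sum (U z0) S) = 0" "deriv (\<lambda>z. h (sum (U z) S)) z0 \<noteq> 0"
  shows "(\<lambda>z. npoint (U z) S) \<in> O[at z0](\<lambda>_. 1)"
proof -
  have "(\<lambda>z. h (sum (U z) S)) holomorphic_on UNIV" using U by (intro holomorphic_intros)
  then have "((\<lambda>z. h (sum (U z) S)) has_field_derivative deriv (\<lambda>z. h (sum (U z) S)) z0) (at z0)"
    by (intro holomorphic_derivI) auto
  moreover have "((\<lambda>z. npoint_numer (U z) S) has_field_derivative
      deriv (\<lambda>z. npoint_numer (U z) S) z0) (at z0)"
    using npoint_numer_analytic_at[OF assms(1) U assms(4)]
    by (simp add: analytic_on_imp_differentiable_at DERIV_deriv_iff_field_differentiable)
  ultimately have "((\<lambda>z. npoint_numer (U z) S / h (sum (U z) S)) \<longlongrightarrow>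
      deriv (\<lambda>z. npoint_numer (U z) S) z0 / deriv (\<lambda>z. h (sum (U z) S)) z0) (at z0)"
    using assms(5-7) by (intro lhopital_complex_simple) auto
  then show ?thesis
    using assms(1,2) by (intro bigoI_tendsto) (auto simp: npoint_eq)
qed

lemma npoint_numer_bigo:
  assumes "finite S" and U: "\<And>i. i \<in> S \<Longrightarrow> (\<lambda>z. U z i) holomorphic_on UNIV"
    and npoint: "\<And>B. B \<subset> S \<Longrightarrow> (\<lambda>z. npoint (U z) B) \<in> O[at z0](\<lambda>_. 1)"
  shows "(\<lambda>z. npoint_numer (U z) S) \<in> O[at z0](\<lambda>_. 1)"
proof -
  have "(\<lambda>z. sderiv (card (S - B)) (sum (U z) B) * npoint (U z) B) \<in> O[at z0](\<lambda>_. 1)"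
    if "B \<subset> S" for B
  proof (rule landau_o.big.mult_in_1)
    show "(\<lambda>z. sderiv (card (S - B)) (sum (U z) B)) \<in> O[at z0](\<lambda>_. 1)"
      using that U by (intro continuous_imp_bigo_1 isCont_sderiv_sum) auto
  qed (rule npoint[OF that])
  then have "(\<lambda>z. \<Sum>B | B \<subset> S. sderiv (card (S - B)) (sum (U z) B) * npoint (U z) B) \<in> O[at z0](\<lambda>_. 1)"
    by (intro big_sum_in_bigo) auto
  then show ?thesis unfolding npoint_numer_def by simp
qed

lemma npoint_numer_bigo_simple_zeros:
  assumes "finite S" and U: "\<And>i. i \<in> S \<Longrightarrow> (\<lambda>z. U z i) holomorphic_on UNIV"
    and zero: "\<And>B. B \<subset> S \<Longrightarrow> B \<noteq> {} \<Longrightarrow> h (sum (U z0) B) = 0 \<Longrightarrow>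
       regular (U z0) B \<and> npoint_numer (U z0) B = 0 \<and> deriv (\<lambda>z. h (sum (U z) B)) z0 \<noteq> 0"
  shows "(\<lambda>z. npoint_numer (U z) S) \<in> O[at z0](\<lambda>_. 1)"
proof -
  have "(\<lambda>z. npoint (U z) B) \<in> O[at z0](\<lambda>_. 1)" if "finite B" "B \<subset> S" for B
    using that
  proof (induction B rule: finite_psubset_induct)
    case (psubset B)
    have U_B: "(\<lambda>z. U z i) holomorphic_on UNIV" if "i \<in> B" for i
      using that psubset.prems U by auto
    consider "B = {}" | "B \<noteq> {}" "h (sum (U z0) B) = 0" | "B \<noteq> {}" "h (sum (U z0) B) \<noteq> 0" by blast
    then show ?case
    proof cases
      case 2
      with zero[OF psubset.prems] show ?thesis
        by (intro npoint_bigo_simple_zero psubset.hyps U_B) simp_all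
    next
      case 3
      have "(\<lambda>z. npoint_numer (U z) B) \<in> O[at z0](\<lambda>_. 1)"
      proof (rule npoint_numer_bigo[OF psubset.hyps U_B])
        show "(\<lambda>z. npoint (U z) C) \<in> O[at z0](\<lambda>_. 1)" if "C \<subset> B" for C
          using that psubset.prems by (intro psubset.IH) blast+
      qed
      moreover have "(\<lambda>z. inverse (h (sum (U z) B))) \<in> O[at z0](\<lambda>_. 1)"
        using isCont_h_sum[OF U_B] 3(2)
        by (intro continuous_imp_bigo_1 continuous_at_within_inverse) auto
      ultimately have "(\<lambda>z. npoint_numer (U z) B * inverse (h (sum (U z) B))) \<in> O[at z0](\<lambda>_. 1)"
        by (rule landau_o.big.mult_in_1)
      then show ?thesis using psubset.hyps 3 by (simp add: npoint_eq divide_inverse)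
    qed simp
  qed
  then show ?thesis
    using assms(1) U finite_subset[of _ S]
    by (intro npoint_numer_bigo) (simp_all add: psubset_imp_subset)
qed

end

section \<open>Liouville's theorem for doubly periodic functions\<close>

lemma lattice_cell_representative:
  fixes \<omega>1 \<omega>2 z :: complex
  assumes "Im (\<omega>1 / \<omega>2) \<noteq> 0"
  obtains k l :: int and y where "z = y + of_int k * \<omega>1 + of_int l * \<omega>2"
    "norm y \<le> norm \<omega>1 + norm \<omega>2"
proof -
  define r where "r = \<omega>1 / \<omega>2"
  define x where "x = Im (z / \<omega>2) / Im r"
  define y where "y = Re (z / \<omega>2) - x * Re r"
  have \<omega>2: "\<omega>2 \<noteq> 0" using assms by auto
  have "z / \<omega>2 = of_real x * r + of_real y"
    using assms by (simp add: complex_eq_iff r_def[symmetric] x_def y_def)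
  then have "z = of_real x * \<omega>1 + of_real y * \<omega>2"
    using \<omega>2 by (simp add: r_def field_simps)
  also have "\<dots> = (of_real (frac x) * \<omega>1 + of_real (frac y) * \<omega>2) + of_int \<lfloor>x\<rfloor> * \<omega>1 + of_int \<lfloor>y\<rfloor> * \<omega>2"
    by (simp add: frac_def algebra_simps)
  finally show thesis
  proof (rule that)
    have "norm (of_real (frac x) * \<omega>1) \<le> norm \<omega>1" "norm (of_real (frac y) * \<omega>2) \<le> norm \<omega>2"
      by (simp_all add: norm_mult mult_left_le_one_le frac_lt_1 less_imp_le)
    then show "norm (of_real (frac x) * \<omega>1 + of_real (frac y) * \<omega>2) \<le> norm \<omega>1 + norm \<omega>2"
      by (intro norm_triangle_mono)
  qed
qed

lemma doubly_periodic_entire_constant: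
  fixes g :: "complex \<Rightarrow> complex"
  assumes g: "g holomorphic_on UNIV" and "Im (\<omega>1 / \<omega>2) \<noteq> 0"
    and "\<And>z. g (z + \<omega>1) = g z" "\<And>z. g (z + \<omega>2) = g z"
  shows "g constant_on UNIV"
proof -
  interpret p1: periodic_fun_simple g \<omega>1 by standard fact
  interpret p2: periodic_fun_simple g \<omega>2 by standard fact
  have "g z \<in> g ` cball 0 (norm \<omega>1 + norm \<omega>2)" for z
  proof -
    obtain k l y where "z = y + of_int k * \<omega>1 + of_int l * \<omega>2" "norm y \<le> norm \<omega>1 + norm \<omega>2"
      using assms(2) by (rule lattice_cell_representative)
    moreover have "g (y + of_int k * \<omega>1 + of_int l * \<omega>2) = g y"
      by (simp only: p1.plus_of_int p2.plus_of_int)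
    ultimately show ?thesis by auto
  qed
  then have "range g \<subseteq> g ` cball 0 (norm \<omega>1 + norm \<omega>2)" by blast
  moreover have "compact (g ` cball 0 (norm \<omega>1 + norm \<omega>2))"
    by (intro compact_continuous_image
        holomorphic_on_imp_continuous_on[OF holomorphic_on_subset[OF g]]) auto
  ultimately have "bounded (range g)" using bounded_subset compact_imp_bounded by blast
  then show ?thesis using Liouville_theorem g by blast
qed

lemma bigo_1_imp_tendsto_remove_sings:
  assumes "isolated_singularity_at f p" "f \<in> O[at p](\<lambda>_. 1)"
  shows "(f \<longlongrightarrow> remove_sings f p) (at p)" "remove_sings f analytic_on {p}"
proof -
  obtain r where r: "r > 0" "f analytic_on ball p r - {p}"
    using assms(1) by (auto simp: isolated_singularity_at_def)
  then obtain g where g: "g holomorphic_on ball p r" "\<forall>z\<in>ball p r - {p}. g z = f z"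
    using holomorphic_on_extend[OF analytic_imp_holomorphic[OF r(2)] _ assms(2)] by auto
  have "isCont g p"
    using g(1) r(1) holomorphic_on_imp_continuous_on continuous_on_eq_continuous_at
    by (metis centre_in_ball open_ball)
  then have "(g \<longlongrightarrow> g p) (at p)" by (simp add: isCont_def)
  then have lim: "(f \<longlongrightarrow> g p) (at p)"
    by (rule Lim_transform_within_open[of _ _ _ _ "ball p r"]) (use r(1) g(2) in auto)
  then show "(f \<longlongrightarrow> remove_sings f p) (at p)" using remove_sings_eqI by metis
  show "remove_sings f analytic_on {p}" using assms(1) lim by (rule remove_sings_analytic_at)
qed

lemma filtermap_add_at:
  fixes p \<omega> :: "'a :: real_normed_vector"
  shows "filtermap (\<lambda>z. z + \<omega>) (at p) = at (p + \<omega>)"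
  using filtermap_at_shift[of "- \<omega>" p] by simp

lemma remove_sings_periodic:
  assumes "\<And>p. eventually (\<lambda>z. f (z + \<omega>) = f z) (at p)"
  shows "remove_sings f (p + \<omega>) = remove_sings f p"
proof -
  have "remove_sings f (p + \<omega>) = remove_sings (\<lambda>z. f (z + \<omega>)) p"
    using remove_sings_compose[OF filtermap_add_at, of f \<omega> p] by (simp add: o_def)
  also have "\<dots> = remove_sings f p" using assms by (rule remove_sings_cong) simp
  finally show ?thesis .
qed

lemma doubly_periodic_removable_constant:
  fixes f :: "complex \<Rightarrow> complex"
  assumes sing: "\<And>p. isolated_singularity_at f p" "\<And>p. f \<in> O[at p](\<lambda>_. 1)"
    and "Im (\<omega>1 / \<omega>2) \<noteq> 0"
    and period: "\<And>p. eventually (\<lambda>z. f (z + \<omega>1) = f z) (at p)"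
      "\<And>p. eventually (\<lambda>z. f (z + \<omega>2) = f z) (at p)"
  obtains c where "\<And>p. (f \<longlongrightarrow> c) (at p)"
proof -
  have "remove_sings f analytic_on {p}" for p using sing by (rule bigo_1_imp_tendsto_remove_sings)
  then have "remove_sings f analytic_on UNIV" using analytic_on_analytic_at by blast
  then have "remove_sings f holomorphic_on UNIV" by (rule analytic_imp_holomorphic)
  then have "remove_sings f constant_on UNIV"
    using assms(3) remove_sings_periodic[OF period(1)] remove_sings_periodic[OF period(2)]
    by (rule doubly_periodic_entire_constant)
  then obtain c where "remove_sings f p = c" for p by (auto simp: constant_on_def)
  then show thesis using that bigo_1_imp_tendsto_remove_sings(1)[OF sing] by metis
qed

lemma bigo_1_periodic:
  fixes f :: "complex \<Rightarrow> complex"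
  assumes "\<And>p. eventually (\<lambda>z. f (z + \<omega>) = f z) (at p)"
  shows "f \<in> O[at (p + of_int k * \<omega>)](\<lambda>_. 1) \<longleftrightarrow> f \<in> O[at p](\<lambda>_. 1)"
proof -
  interpret periodic_fun_simple "\<lambda>p. f \<in> O[at p](\<lambda>_. 1)" \<omega>
  proof
    fix p
    have "f \<in> O[at (p + \<omega>)](\<lambda>_. 1) \<longleftrightarrow> (\<lambda>z. f (z + \<omega>)) \<in> O[at p](\<lambda>_. 1)"
      by (simp add: landau_o.big.in_filtermap_iff flip: filtermap_add_at)
    also have "\<dots> \<longleftrightarrow> f \<in> O[at p](\<lambda>_. 1)"
      using assms by (rule landau_o.big.in_cong)
    finally show "f \<in> O[at (p + \<omega>)](\<lambda>_. 1) \<longleftrightarrow> f \<in> O[at p](\<lambda>_. 1)" .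
  qed
  show ?thesis by (rule plus_of_int)
qed

section \<open>Vanishing along a generic line in the hyperplane\<close>

locale generic_hyperplane = theta_like +
  fixes u :: "'a \<Rightarrow> complex" and a b :: 'a and S :: "'a set"
  assumes finite: "finite S" and distinct: "a \<noteq> b" "a \<notin> S" "b \<notin> S"
    and generic: "\<And>B C. B \<subseteq> S \<Longrightarrow> C \<subseteq> S \<Longrightarrow> B \<noteq> C \<Longrightarrow> h (sum u B - sum u C) \<noteq> 0"
    and vanishing: "vanishing_below (insert a (insert b S))"
begin

abbreviation I :: "'a set" where
  "I \<equiv> insert a (insert b S)"

definition line :: "complex \<Rightarrow> 'a \<Rightarrow> complex" where
  "line z = u(a := z, b := - sum u S - z)"

definition singular :: "complex set" where
  "singular = {z. \<exists>B\<subseteq>S. h (z + sum u B) = 0}"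

lemma finite_I: "finite I"
  using finite by simp

lemma finite_subset_S: "B \<subseteq> S \<Longrightarrow> finite B"
  using finite by (rule rev_finite_subset)

lemma line_holomorphic: "(\<lambda>z. line z i) holomorphic_on A"
  unfolding line_def fun_upd_def
  by (cases "i = b"; cases "i = a") (simp_all add: holomorphic_intros)

lemma sum_diff_S: "B \<subseteq> S \<Longrightarrow> sum u S = sum u B + sum u (S - B)"
  using finite by (simp add: sum.subset_diff add.commute)

lemma sum_line: "B \<subseteq> S \<Longrightarrow> sum (line z) B = sum u B"
  using distinct by (intro sum.cong) (auto simp: line_def)

lemma sum_line_a: "B \<subseteq> S \<Longrightarrow> sum (line z) (insert a B) = z + sum u B"
  using distinct finite_subset_S[of B] sum_line[of B z] by (subst sum.insert) (auto simp: line_def)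

lemma sum_line_b: "B \<subseteq> S \<Longrightarrow> sum (line z) (insert b B) = - (z + sum u (S - B))"
  using distinct finite_subset_S[of B] sum_line[of B z] sum_diff_S[of B]
  by (subst sum.insert) (auto simp: line_def)

lemma sum_line_ab: "B \<subseteq> S \<Longrightarrow> sum (line z) (insert a (insert b B)) = - sum u (S - B)"
  using distinct finite_subset_S[of B] sum_line_b[of B z] by (subst sum.insert) (auto simp: line_def)

lemma sum_line_I: "sum (line z) I = 0"
  using sum_line_ab[of S z] by simp

lemma h_sum_nonzero: "B \<subseteq> S \<Longrightarrow> B \<noteq> {} \<Longrightarrow> h (sum u B) \<noteq> 0"
  using generic[of B "{}"] by simp

text \<open>The sums over \<open>insert a B\<close> and its complement \<open>insert b (S - B)\<close> are opposite; all other proper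
  sums are constant along the line, hence nonzero by genericity.\<close>

lemma h_sum_line_eq_0_cases:
  assumes "C \<subset> I" "C \<noteq> {}" "h (sum (line z) C) = 0"
  obtains B where "B \<subseteq> S" "C = insert a B" "h (z + sum u B) = 0"
    | B where "B \<subseteq> S" "C = insert b (S - B)" "h (z + sum u B) = 0"
proof -
  define B where "B = C \<inter> S"
  have B: "B \<subseteq> S" "S - (S - B) = B" by (auto simp: B_def)
  consider "C = B" | "C = insert a B" | "C = insert b B" | "C = insert a (insert b B)"
    using assms(1) by (auto simp: B_def)
  then show thesis
  proof cases
    case 1
    then show thesis using assms(2,3) B(1) h_sum_nonzero by (simp add: sum_line)
  next
    case 2
    then show thesis using that(1)[OF B(1)] assms(3) B(1) by (simp add: sum_line_a)
  next
    case 3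
    then show thesis
      using that(2)[of "S - B"] assms(3) B by (simp only: sum_line_b h_minus_eq_0_iff Diff_subset)
  next
    case 4
    then have "S - B \<noteq> {}" using assms(1) by auto
    then show thesis
      using assms(3) 4 B(1) h_sum_nonzero[of "S - B"] by (simp only: sum_line_ab h_minus_eq_0_iff) auto
  qed
qed

lemma regular_line:
  assumes "z \<notin> singular"
  shows "regular (line z) I"
proof (rule regularI, rule notI)
  fix C assume "C \<subset> I" "C \<noteq> {}" "h (sum (line z) C) = 0"
  then show False
    by (cases rule: h_sum_line_eq_0_cases) (use assms in \<open>auto simp: singular_def\<close>)
qed

lemma eventually_not_singular: "eventually (\<lambda>z. z \<notin> singular) (at p)"
proof -
  have "eventually (\<lambda>z. \<forall>B\<in>Pow S. h (sum u B + z * 1) \<noteq> 0) (at p)"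
    using finite by (intro eventually_ball_finite ballI h_affine_eventually_nonzero) auto
  then show ?thesis by (rule eventually_mono) (auto simp: singular_def add.commute)
qed

lemma npoint_numer_line_add_tau:
  assumes "z \<notin> singular"
  shows "npoint_numer (line (z + \<tau>)) I = npoint_numer (line z) I"
proof -
  have "line (z + \<tau>) = (line z)(a := line z a + \<tau>, b := line z b - \<tau>)"
    using distinct by (auto simp: line_def)
  then show ?thesis
    using npoint_numer_opposite_shifts[of I a b "line z"] vanishing finite_I distinct
      regular_line[OF assms] sum_line_I by simp
qed

lemma npoint_numer_line_add_2pi_i:
  "npoint_numer (line (z + 2 * pi * \<i>)) I = npoint_numer (line z) I"
proof -
  define v where "v = (line z)(a := line z a + of_int 1 * (2 * pi * \<i>))"
  have "line (z + 2 * pi * \<i>) = v(b := v b + of_int (- 1) * (2 * pi * \<i>))"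
    using distinct by (auto simp: line_def v_def)
  then have "npoint_numer (line (z + 2 * pi * \<i>)) I = npoint_numer v I"
    using npoint_numer_shift_2pi_i[OF finite_I, of v b "- 1"] by (simp only:)
  also have "\<dots> = npoint_numer (line z) I"
    unfolding v_def by (rule npoint_numer_shift_2pi_i[OF finite_I])
  finally show ?thesis .
qed

lemma npoint_numer_line_tendsto_0_at_0: "((\<lambda>z. npoint_numer (line z) I) \<longlongrightarrow> 0) (at 0)"
proof (rule npoint_numer_hyperplane_tendsto_0)
  show "finite (insert b S)" "a \<notin> insert b S" using finite distinct by auto
  show "line z a = z" for z using distinct by (simp add: line_def)
  show "(\<lambda>z. line z i) holomorphic_on UNIV" for i by (rule line_holomorphic)
  show "sum (line z) (insert b S) = - z" for z by (simp add: sum_line_b)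
  show "regular (line 0) (insert b S)"
  proof (rule regularI, rule notI)
    fix C assume C: "C \<subset> insert b S" "C \<noteq> {}" "h (sum (line 0) C) = 0"
    then have "C \<subset> I" by blast
    then show False using C(2,3)
    proof (cases rule: h_sum_line_eq_0_cases)
      case (1 B)
      then show False using C(1) distinct by auto
    next
      case (2 B)
      then have "B \<noteq> {}" using C(1) by auto
      then show False using 2 h_sum_nonzero by simp
    qed
  qed
qed

lemma npoint_numer_line_tendsto_0_at_minus_sum:
  "((\<lambda>z. npoint_numer (line z) I) \<longlongrightarrow> 0) (at (- sum u S))"
proof -
  interpret swap: generic_hyperplane h \<tau> c u b a S
    using finite distinct generic vanishing by unfold_locales (auto simp: insert_commute)
  have "swap.line z = line (- sum u S - z)" for z
    using distinct by (auto simp: line_def swap.line_def)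
  then have "((\<lambda>z. npoint_numer (line (- sum u S - z)) I) \<longlongrightarrow> 0) (at 0)"
    using swap.npoint_numer_line_tendsto_0_at_0 by (simp add: insert_commute)
  moreover have "filterlim (\<lambda>z. - sum u S - z) (at 0) (at (- sum u S))"
  proof (rule filterlim_atI)
    show "eventually (\<lambda>z. - sum u S - z \<noteq> 0) (at (- sum u S))"
      using eventually_neq_at_within[of "- sum u S"] by (rule eventually_mono) auto
  qed (auto intro!: tendsto_eq_intros)
  ultimately show ?thesis using filterlim_compose by fastforce
qed

lemma h_sum_line_eq_0_at_minus_sum:
  assumes "B \<subseteq> S" and C: "C \<subset> I" "C \<noteq> {}" "h (sum (line (- sum u B)) C) = 0"
  shows "C = insert a B \<or> C = insert b (S - B)"
proof -
  have "D = B" if "D \<subseteq> S" "h (- sum u B + sum u D) = 0" for D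
    using generic[of D B] that assms(1) by auto
  with C show ?thesis by (cases rule: h_sum_line_eq_0_cases) auto
qed

text \<open>Neither of the two sets with zero sum contains the other, so they are regular at this point and
  the induction hypothesis makes their numerators vanish.\<close>

lemma npoint_numer_line_bigo_interior:
  assumes B: "B \<subseteq> S" "B \<noteq> {}" "B \<noteq> S"
  shows "(\<lambda>z. npoint_numer (line z) I) \<in> O[at (- sum u B)](\<lambda>_. 1)"
proof (rule npoint_numer_bigo_simple_zeros[OF finite_I line_holomorphic])
  let ?z0 = "- sum u B"
  note zero_sets = h_sum_line_eq_0_at_minus_sum[OF B(1)]
  fix C assume C: "C \<subset> I" "C \<noteq> {}" "h (sum (line ?z0) C) = 0"
  have "regular (line ?z0) C"
  proof (rule regularI, rule notI)
    fix A assume A: "A \<subset> C" "A \<noteq> {}" "h (sum (line ?z0) A) = 0"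
    then have "A \<subset> I" using C(1) by blast
    then show False using zero_sets[OF C] zero_sets[OF _ A(2,3)] A(1) distinct B by auto
  qed
  moreover have "\<exists>m. m \<noteq> 0 \<and> (\<forall>z. sum (line z) C = m * (z - ?z0))"
    using zero_sets[OF C]
  proof
    assume "C = insert a B"
    then show ?thesis using B(1) by (intro exI[of _ 1]) (simp add: sum_line_a)
  next
    assume "C = insert b (S - B)"
    then show ?thesis using B(1) by (intro exI[of _ "- 1"]) (simp add: sum_line_b double_diff)
  qed
  then obtain m where m: "m \<noteq> 0" "\<And>z. sum (line z) C = m * (z - ?z0)" by blast
  moreover have "2 \<le> card C"
  proof -
    have "a \<notin> B" "Suc 0 \<le> card B" "Suc 0 \<le> card (S - B)"
      using B finite finite_subset_S[of B] distinct by (auto simp: Suc_le_eq card_gt_0_iff)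
    then show ?thesis
      using zero_sets[OF C] distinct finite finite_subset_S[OF B(1)] by auto
  qed
  moreover have "sum (line ?z0) C = 0" by (simp add: m(2))
  ultimately show "regular (line ?z0) C \<and> npoint_numer (line ?z0) C = 0
      \<and> deriv (\<lambda>z. h (sum (line z) C)) ?z0 \<noteq> 0"
    using vanishing_belowD[OF vanishing C(1)] deriv_h_affine_at_zero[OF m(2)] by simp
qed

lemma npoint_numer_line_bigo_at_minus_sum:
  assumes "B \<subseteq> S"
  shows "(\<lambda>z. npoint_numer (line z) I) \<in> O[at (- sum u B)](\<lambda>_. 1)"
proof -
  have tendsto: "(\<lambda>z. npoint_numer (line z) I) \<in> O[at p](\<lambda>_. 1)"
    if "((\<lambda>z. npoint_numer (line z) I) \<longlongrightarrow> 0) (at p)" for p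
    using that by (intro bigoI_tendsto) auto
  consider "B = {}" | "B = S" | "B \<noteq> {}" "B \<noteq> S" by blast
  then show ?thesis
  proof cases
    case 1
    then show ?thesis using tendsto[OF npoint_numer_line_tendsto_0_at_0] by simp
  next
    case 2
    then show ?thesis using tendsto[OF npoint_numer_line_tendsto_0_at_minus_sum] by simp
  next
    case 3
    then show ?thesis using assms by (intro npoint_numer_line_bigo_interior)
  qed
qed

lemma eventually_npoint_numer_line_add_tau:
  "eventually (\<lambda>z. npoint_numer (line (z + \<tau>)) I = npoint_numer (line z) I) (at p)"
  using eventually_not_singular by (rule eventually_mono) (rule npoint_numer_line_add_tau)

lemma eventually_npoint_numer_line_add_2pi_i:
  "eventually (\<lambda>z. npoint_numer (line (z + 2 * pi * \<i>)) I = npoint_numer (line z) I) (at p)"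
  by (intro always_eventually allI npoint_numer_line_add_2pi_i)

lemma npoint_numer_line_analytic_at:
  "z \<notin> singular \<Longrightarrow> (\<lambda>z. npoint_numer (line z) I) analytic_on {z}"
  by (intro npoint_numer_analytic_at finite_I line_holomorphic regular_line)

lemma npoint_numer_line_bigo: "(\<lambda>z. npoint_numer (line z) I) \<in> O[at p](\<lambda>_. 1)"
proof (cases "p \<in> singular")
  case True
  then obtain B k l where B: "B \<subseteq> S" and kl: "p + sum u B = of_int k * \<tau> + of_int l * (2 * pi * \<i>)"
    unfolding singular_def using zeros by blast
  have "p = - sum u B + of_int k * \<tau> + of_int l * (2 * pi * \<i>)"
    using kl by (simp add: algebra_simps)
  then show ?thesis
    using npoint_numer_line_bigo_at_minus_sum[OF B]
    by (simp only: bigo_1_periodic[OF eventually_npoint_numer_line_add_tau]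
        bigo_1_periodic[OF eventually_npoint_numer_line_add_2pi_i])
next
  case False
  then show ?thesis
    by (intro continuous_imp_bigo_1 analytic_at_imp_isCont npoint_numer_line_analytic_at)
qed

lemma npoint_numer_line_eq_0:
  assumes "z \<notin> singular"
  shows "npoint_numer (line z) I = 0"
proof -
  let ?f = "\<lambda>z. npoint_numer (line z) I"
  have "isolated_singularity_at ?f p" for p
    unfolding isolated_singularity_at_altdef
    using eventually_not_singular by (rule eventually_mono) (rule npoint_numer_line_analytic_at)
  moreover have "Im (\<tau> / (2 * pi * \<i>)) \<noteq> 0" using Re_tau by (simp add: Im_divide)
  ultimately obtain c where c: "\<And>p. (?f \<longlongrightarrow> c) (at p)"
    using doubly_periodic_removable_constant[OF _ npoint_numer_line_bigo _
        eventually_npoint_numer_line_add_tau eventually_npoint_numer_line_add_2pi_i]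
    by blast
  have "c = 0" using LIM_unique[OF c npoint_numer_line_tendsto_0_at_0] .
  moreover have "isCont ?f z"
    using npoint_numer_line_analytic_at[OF assms] by (rule analytic_at_imp_isCont)
  ultimately show ?thesis using LIM_unique[OF c[of z]] by (simp add: isCont_def)
qed

end

section \<open>Vanishing on the hyperplane\<close>

context theta_like
begin

lemma eventually_distinct_subset_sums:
  assumes "finite S"
  obtains d :: "'a \<Rightarrow> nat" where
    "eventually (\<lambda>\<epsilon>. \<forall>B C. B \<subseteq> S \<longrightarrow> C \<subseteq> S \<longrightarrow> B \<noteq> C \<longrightarrow>
       h ((\<Sum>i\<in>B. u i + \<epsilon> * of_nat (d i)) - (\<Sum>i\<in>C. u i + \<epsilon> * of_nat (d i))) \<noteq> 0) (at 0)"
proof -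
  obtain d :: "'a \<Rightarrow> nat" where d: "inj_on (sum d) (Pow S)"
    using exists_distinct_subset_sums[OF assms] by blast
  have "eventually (\<lambda>\<epsilon>. B \<noteq> C \<longrightarrow>
      h ((\<Sum>i\<in>B. u i + \<epsilon> * of_nat (d i)) - (\<Sum>i\<in>C. u i + \<epsilon> * of_nat (d i))) \<noteq> 0) (at 0)"
    if "B \<in> Pow S" "C \<in> Pow S" for B C
  proof (cases "B = C")
    case False
    then have "sum d B \<noteq> sum d C" using d that by (auto dest: inj_onD)
    then have "of_nat (sum d B) - of_nat (sum d C) \<noteq> (0 :: complex)"
      by (simp del: of_nat_sum)
    then have "eventually (\<lambda>\<epsilon>. h (sum u B - sum u C
        + \<epsilon> * (of_nat (sum d B) - of_nat (sum d C))) \<noteq> 0) (at 0)"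
      by (rule h_affine_eventually_nonzero)
    then show ?thesis
      by (rule eventually_mono) (simp add: sum.distrib sum_distrib_left algebra_simps)
  qed simp
  then have "eventually (\<lambda>\<epsilon>. \<forall>B\<in>Pow S. \<forall>C\<in>Pow S. B \<noteq> C \<longrightarrow>
      h ((\<Sum>i\<in>B. u i + \<epsilon> * of_nat (d i)) - (\<Sum>i\<in>C. u i + \<epsilon> * of_nat (d i))) \<noteq> 0) (at 0)"
    using assms by (intro eventually_ball_finite ballI) auto
  then show thesis by (intro that) (simp add: Pow_iff Ball_def)
qed

lemma npoint_numer_generic_eq_0:
  assumes S: "finite S" "a \<noteq> b" "a \<notin> S" "b \<notin> S"
    and generic: "\<And>B C. B \<subseteq> S \<Longrightarrow> C \<subseteq> S \<Longrightarrow> B \<noteq> C \<Longrightarrow> h (sum u B - sum u C) \<noteq> 0"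
    and van: "vanishing_below (insert a (insert b S))"
    and u: "sum u (insert a (insert b S)) = 0" "regular u (insert a (insert b S))"
  shows "npoint_numer u (insert a (insert b S)) = 0"
proof -
  interpret generic_hyperplane h \<tau> c u a b S
    using S generic van by unfold_locales auto
  have "u b = - sum u S - u a" using u(1) S by (simp add: algebra_simps eq_neg_iff_add_eq_0)
  then have "line (u a) = u" using S(2) by (auto simp: line_def)
  moreover have "u a \<notin> singular"
  proof
    assume "u a \<in> singular"
    then obtain B where B: "B \<subseteq> S" "h (u a + sum u B) = 0" by (auto simp: singular_def)
    then have "a \<notin> B" "finite B" using S finite_subset_S[of B] by auto
    with B(2) have "h (sum u (insert a B)) = 0" by simp
    moreover have "insert a B \<subset> I" using B(1) S by auto
    ultimately show False using regularD[OF u(2)] by blast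
  qed
  ultimately show ?thesis using npoint_numer_line_eq_0[of "u a"] by simp
qed

text \<open>Perturb the variables in \<open>S\<close> generically and correct \<open>b\<close> to stay on the hyperplane.\<close>

lemma exists_generic_perturbation:
  assumes S: "finite S" "a \<noteq> b" "a \<notin> S" "b \<notin> S" and sum: "sum u (insert a (insert b S)) = 0"
  obtains v where "v 0 = u" "\<And>i. (\<lambda>\<epsilon>. v \<epsilon> i) holomorphic_on UNIV"
    "\<And>\<epsilon>. sum (v \<epsilon>) (insert a (insert b S)) = 0"
    "eventually (\<lambda>\<epsilon>. \<forall>B C. B \<subseteq> S \<longrightarrow> C \<subseteq> S \<longrightarrow> B \<noteq> C \<longrightarrow> h (sum (v \<epsilon>) B - sum (v \<epsilon>) C) \<noteq> 0) (at 0)"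
proof -
  obtain d where d: "eventually (\<lambda>\<epsilon>. \<forall>B C. B \<subseteq> S \<longrightarrow> C \<subseteq> S \<longrightarrow> B \<noteq> C \<longrightarrow>
      h ((\<Sum>i\<in>B. u i + \<epsilon> * of_nat (d i)) - (\<Sum>i\<in>C. u i + \<epsilon> * of_nat (d i))) \<noteq> 0) (at 0)"
    using eventually_distinct_subset_sums[OF S(1)] by blast
  define v where "v \<epsilon> = (\<lambda>i. u i + \<epsilon> * of_nat (d i))
    (a := u a, b := - (\<Sum>i\<in>S. u i + \<epsilon> * of_nat (d i)) - u a)" for \<epsilon>
  have v_S: "sum (v \<epsilon>) B = (\<Sum>i\<in>B. u i + \<epsilon> * of_nat (d i))" if "B \<subseteq> S" for B \<epsilon>
    using that S by (intro sum.cong) (auto simp: v_def)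
  show thesis
  proof (rule that)
    have "u b = - sum u S - u a" using sum S by (simp add: algebra_simps eq_neg_iff_add_eq_0)
    then show "v 0 = u" using S(2) by (auto simp: v_def)
    show "(\<lambda>\<epsilon>. v \<epsilon> i) holomorphic_on UNIV" for i
      unfolding v_def by (cases "i = a"; cases "i = b") (auto intro!: holomorphic_intros)
    show "sum (v \<epsilon>) (insert a (insert b S)) = 0" for \<epsilon>
      using S v_S[of S \<epsilon>] by (simp add: v_def)
    show "eventually (\<lambda>\<epsilon>. \<forall>B C. B \<subseteq> S \<longrightarrow> C \<subseteq> S \<longrightarrow> B \<noteq> C \<longrightarrow>
        h (sum (v \<epsilon>) B - sum (v \<epsilon>) C) \<noteq> 0) (at 0)"
      using d by (rule eventually_mono) (simp add: v_S)
  qed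
qed

lemma vanishing_below_imp_npoint_numer_eq_0:
  assumes van: "vanishing_below S" and S: "finite S" "2 \<le> card S"
    and u: "sum u S = 0" "regular u S"
  shows "npoint_numer u S = 0"
proof -
  have "\<not> card S \<le> Suc 0" using S(2) by simp
  then obtain a b where ab: "a \<in> S" "b \<in> S" "a \<noteq> b"
    unfolding card_le_Suc0_iff_eq[OF S(1)] by blast
  define R where "R = S - {a, b}"
  have R: "S = insert a (insert b R)" "finite R" "a \<notin> R" "b \<notin> R"
    using ab S by (auto simp: R_def)
  obtain v where v: "v 0 = u" "\<And>i. (\<lambda>\<epsilon>. v \<epsilon> i) holomorphic_on UNIV" "\<And>\<epsilon>. sum (v \<epsilon>) S = 0"
      "eventually (\<lambda>\<epsilon>. \<forall>B C. B \<subseteq> R \<longrightarrow> C \<subseteq> R \<longrightarrow> B \<noteq> C \<longrightarrow> h (sum (v \<epsilon>) B - sum (v \<epsilon>) C) \<noteq> 0) (at 0)"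
    by (rule exists_generic_perturbation[OF R(2) ab(3) R(3,4), folded R(1), OF u(1)]) (rule that)
  have "eventually (\<lambda>\<epsilon>. \<epsilon> \<in> {\<epsilon>. regular (v \<epsilon>) S}) (at 0)"
    using open_regular[of S v] S(1) v(1,2) u(2) by (intro eventually_at_in_open') auto
  with v(4) have "eventually (\<lambda>\<epsilon>. npoint_numer (v \<epsilon>) S = 0) (at 0)"
  proof eventually_elim
    case (elim \<epsilon>)
    then show ?case
      using npoint_numer_generic_eq_0[of R a b "v \<epsilon>"] R ab(3) van v(3)[of \<epsilon>] by simp
  qed
  then have "((\<lambda>\<epsilon>. npoint_numer (v \<epsilon>) S) \<longlongrightarrow> 0) (at 0)" by (rule tendsto_eventually)
  moreover have "isCont (\<lambda>\<epsilon>. npoint_numer (v \<epsilon>) S) 0"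
    using S(1) v(1,2) u(2) by (intro isCont_npoint_numer) simp_all
  ultimately have "npoint_numer (v 0) S = 0" using LIM_unique by (auto simp: isCont_def)
  then show ?thesis by (simp add: v(1))
qed

lemma vanishing_below_finite:
  assumes "finite S"
  shows "vanishing_below S"
  using assms
proof (induction S rule: finite_psubset_induct)
  case (psubset S)
  show ?case
    unfolding vanishing_below_def
  proof (intro allI impI)
    fix u R assume R: "R \<subset> S" "2 \<le> card R" "sum u R = 0" "regular u R"
    moreover have "finite R" using R(1) psubset.hyps by (auto intro: finite_subset)
    ultimately show "npoint_numer u R = 0"
      using psubset.IH[OF R(1)] by (intro vanishing_below_imp_npoint_numer_eq_0)
  qed
qed

theorem npoint_numer_eq_0:
  assumes S: "finite S" "2 \<le> card S" "regular u S" and sum: "sum u S = of_int k * (2 * pi * \<i>)"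
  shows "npoint_numer u S = 0"
proof -
  obtain a where a: "a \<in> S" using S(2) by fastforce
  let ?v = "u(a := u a + of_int (- k) * (2 * pi * \<i>))"
  have "regular ?v S" using S(3,1) h_shift_2pi_i_eq_0_iff by (rule regular_shift)
  moreover have "sum ?v S = 0"
    unfolding sum_fun_upd_add[OF S(1)] using a sum by simp
  ultimately have "npoint_numer ?v S = 0"
    using S(1,2) by (intro vanishing_below_imp_npoint_numer_eq_0 vanishing_below_finite)
  then show ?thesis by (simp only: npoint_numer_shift_2pi_i[OF S(1)])
qed

end

section \<open>The theta function\<close>

lemma convergent_prod_qpoch:
  assumes "norm q < 1"
  shows "convergent_prod (\<lambda>j. 1 - a * q ^ j :: complex)"
proof -
  have "summable (\<lambda>j. norm a * norm q ^ j)"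
    using assms by (intro summable_mult summable_geometric) auto
  then have "summable (\<lambda>j. norm (1 - a * q ^ j - 1))"
    by (simp add: norm_mult norm_power)
  then show ?thesis
    by (intro abs_convergent_prod_imp_convergent_prod summable_imp_abs_convergent_prod)
qed

lemma qpoch_rec:
  assumes "norm q < 1"
  shows "qpoch q a = (1 - a) * qpoch q (a * q)"
proof -
  have "(\<lambda>j. 1 - a * q ^ j) has_prod ((\<Prod>j<1. 1 - a * q ^ j) * (\<Prod>j. 1 - a * q ^ (j + 1)))"
    by (rule has_prod_ignore_initial_segment'[OF convergent_prod_qpoch[OF assms]])
  then show ?thesis
    by (simp add: qpoch_def has_prod_unique[symmetric] mult_ac)
qed

lemma qpoch_eq_0_imp:
  assumes "norm q < 1" "qpoch q a = 0"
  shows "\<exists>j. a * q ^ j = 1"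
  using prodinf_nonzero[OF convergent_prod_qpoch[OF assms(1)], of a] assms(2)
  by (auto simp: qpoch_def)

lemma qpoch_q_nonzero:
  assumes "norm q < 1"
  shows "qpoch q q \<noteq> 0"
proof
  assume "qpoch q q = 0"
  then obtain j where "q * q ^ j = 1" using qpoch_eq_0_imp[OF assms] by blast
  then have "norm q ^ Suc j = 1" by (metis norm_one norm_power power_Suc)
  moreover have "norm q ^ Suc j \<le> norm q ^ 1" using assms by (intro power_decreasing) auto
  ultimately show False using assms by simp
qed

lemma qpoch_uniform_limit:
  assumes "norm q < 1" "compact A"
  shows "uniform_limit A (\<lambda>N a. \<Prod>j<N. 1 - a * q ^ j) (qpoch q) sequentially"
proof -
  obtain M where M: "\<And>a. a \<in> A \<Longrightarrow> norm a \<le> M"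
    using compact_imp_bounded[OF assms(2)] by (auto simp: bounded_iff)
  have "uniformly_convergent_on A (\<lambda>N a. \<Prod>j<N. 1 - a * q ^ j)"
  proof (rule uniformly_convergent_on_prod'[OF _ assms(2)])
    show "uniformly_convergent_on A (\<lambda>N a. \<Sum>j<N. norm (1 - a * q ^ j - 1))"
    proof (rule Weierstrass_m_test')
      show "norm (norm (1 - a * q ^ j - 1)) \<le> M * norm q ^ j" if "a \<in> A" for j a
        using M[OF that] by (simp add: norm_mult norm_power mult_right_mono)
      show "summable (\<lambda>j. M * norm q ^ j)"
        using assms(1) by (intro summable_mult summable_geometric) auto
    qed
  qed (auto intro!: continuous_intros)
  then have "uniform_limit A (\<lambda>N a. \<Prod>j<N. 1 - a * q ^ j)
      (\<lambda>a. lim (\<lambda>N. \<Prod>j<N. 1 - a * q ^ j)) sequentially"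
    by (simp only: uniformly_convergent_uniform_limit_iff)
  moreover have "lim (\<lambda>N. \<Prod>j<N. 1 - a * q ^ j) = qpoch q a" for a
  proof (rule limI)
    have "(\<lambda>N. \<Prod>j\<le>N. 1 - a * q ^ j) \<longlonglongrightarrow> qpoch q a"
      unfolding qpoch_def by (rule convergent_prod_LIMSEQ[OF convergent_prod_qpoch[OF assms(1)]])
    then show "(\<lambda>N. \<Prod>j<N. 1 - a * q ^ j) \<longlonglongrightarrow> qpoch q a"
      by (simp add: LIMSEQ_lessThan_iff_atMost)
  qed
  ultimately show ?thesis by simp
qed

lemma qpoch_holomorphic:
  assumes "norm q < 1" "f holomorphic_on A"
  shows "(\<lambda>z. qpoch q (f z)) holomorphic_on A"
proof -
  have "qpoch q holomorphic_on UNIV"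
  proof (rule holomorphic_uniform_sequence[where f = "\<lambda>N a. \<Prod>j<N. 1 - a * q ^ j"])
    show "(\<lambda>a. \<Prod>j<N. 1 - a * q ^ j) holomorphic_on UNIV" for N by (intro holomorphic_intros)
    show "\<exists>d>0. cball z d \<subseteq> UNIV \<and>
        uniform_limit (cball z d) (\<lambda>N a. \<Prod>j<N. 1 - a * q ^ j) (qpoch q) sequentially" for z
      using qpoch_uniform_limit[OF assms(1) compact_cball] by (intro exI[of _ 1]) simp
  qed simp
  then show ?thesis
    using holomorphic_on_compose_gen[OF assms(2), of "qpoch q" UNIV] by (simp add: o_def)
qed

lemma theta_minus: "theta q (- s) = - theta q s"
  unfolding theta_def by (simp add: algebra_simps diff_divide_distrib)

lemma theta_inverse: "theta q (1 / s) = - theta q s"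
  unfolding theta_def by (simp add: power_one_over algebra_simps diff_divide_distrib)

lemma theta_mult_sqrt_nome:
  assumes "norm (r\<^sup>2) < 1" "r \<noteq> 0" "s \<noteq> 0"
  shows "theta (r\<^sup>2) (s * r) = - 1 / r * (1 / s\<^sup>2) * theta (r\<^sup>2) s"
proof -
  define q where "q = r\<^sup>2"
  have rec: "qpoch q (q * s\<^sup>2) = (1 - q * s\<^sup>2) * qpoch q (q * s\<^sup>2 * q)"
    "qpoch q (1 / s\<^sup>2) = (1 - 1 / s\<^sup>2) * qpoch q (q / s\<^sup>2)"
    using qpoch_rec[of q "q * s\<^sup>2"] qpoch_rec[of q "1 / s\<^sup>2"] assms(1) by (simp_all add: q_def)
  have factor: "(s * r - 1 / (s * r)) * (1 - 1 / s\<^sup>2) = - 1 / r * (1 / s\<^sup>2) * (s - 1 / s) * (1 - q * s\<^sup>2)"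
    using assms by (simp add: q_def field_simps power2_eq_square)
  have "q * (s * r)\<^sup>2 = q * s\<^sup>2 * q" "q / (s * r)\<^sup>2 = 1 / s\<^sup>2"
    using assms by (simp_all add: q_def power_mult_distrib)
  then have "theta q (s * r) = ((s * r - 1 / (s * r)) * (1 - 1 / s\<^sup>2))
      * (qpoch q (q * s\<^sup>2 * q) * qpoch q (q / s\<^sup>2) / (qpoch q q)\<^sup>2)"
    unfolding theta_def by (simp only: rec(2)) simp
  also have "\<dots> = - 1 / r * (1 / s\<^sup>2) * theta q s"
    unfolding factor theta_def rec(1) by simp
  finally show ?thesis unfolding q_def .
qed

lemma theta_eq_0_imp:
  assumes "q \<noteq> 0" "norm q < 1" "s \<noteq> 0" "theta q s = 0"
  shows "\<exists>k :: int. s\<^sup>2 = q powi k"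
proof -
  consider "s = 1 / s" | "qpoch q (q * s\<^sup>2) = 0" | "qpoch q (q / s\<^sup>2) = 0"
    using assms(4) qpoch_q_nonzero[OF assms(2)] by (auto simp: theta_def)
  then show ?thesis
  proof cases
    case 1
    then have "s\<^sup>2 = q powi 0" using assms(3) by (simp add: power2_eq_square field_simps)
    then show ?thesis by blast
  next
    case 2
    then obtain j where "q * s\<^sup>2 * q ^ j = 1" using qpoch_eq_0_imp[OF assms(2)] by blast
    then have "s\<^sup>2 = q powi - int (Suc j)"
      unfolding power_int_minus power_int_of_nat using assms(1) by (simp add: field_simps)
    then show ?thesis by blast
  next
    case 3
    then obtain j where "q / s\<^sup>2 * q ^ j = 1" using qpoch_eq_0_imp[OF assms(2)] by blast
    then have "s\<^sup>2 = q powi int (Suc j)"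
      unfolding power_int_of_nat using assms(3) by (simp add: field_simps)
    then show ?thesis by blast
  qed
qed

lemma theta_holomorphic:
  assumes "norm q < 1"
  shows "theta q holomorphic_on - {0}"
  unfolding theta_def using qpoch_q_nonzero[OF assms]
  by (intro holomorphic_intros qpoch_holomorphic[OF assms]) auto

lemma thetaD_holomorphic:
  assumes "norm q < 1"
  shows "thetaD q k holomorphic_on - {0}"
  using theta_holomorphic[OF assms] by (induction k) (auto intro!: holomorphic_intros)

definition theta_log :: "complex \<Rightarrow> complex \<Rightarrow> complex" where
  "theta_log q z = theta q (exp (z / 2))"

lemma theta_log_holomorphic:
  assumes "norm q < 1"
  shows "theta_log q holomorphic_on UNIV"
proof -
  have "(theta q \<circ> (\<lambda>z. exp (z / 2))) holomorphic_on UNIV"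
    by (intro holomorphic_on_compose_gen[OF _ theta_holomorphic[OF assms]] holomorphic_intros) auto
  then show ?thesis by (simp add: o_def theta_log_def[abs_def])
qed

lemma deriv_theta_log_0:
  assumes "norm q < 1"
  shows "deriv (theta_log q) 0 = 1"
proof -
  define K where "K z = qpoch q (q * exp z) * qpoch q (q * exp (- z)) / (qpoch q q)\<^sup>2" for z
  have theta_log: "theta_log q = (\<lambda>z. (exp (z / 2) - exp (- (z / 2))) * K z)"
    by (auto simp: theta_log_def theta_def K_def exp_minus field_simps simp flip: exp_double)
  have "K holomorphic_on UNIV"
    unfolding K_def using qpoch_q_nonzero[OF assms]
    by (intro holomorphic_intros qpoch_holomorphic[OF assms]) auto
  then have "(K has_field_derivative deriv K 0) (at 0)" by (intro holomorphic_derivI) auto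
  moreover have "((\<lambda>z :: complex. exp (z / 2) - exp (- (z / 2))) has_field_derivative 1) (at 0)"
    by (auto intro!: derivative_eq_intros)
  ultimately have "(theta_log q has_field_derivative
      1 * K 0 + deriv K 0 * (exp (0 / 2) - exp (- (0 / 2)))) (at 0)"
    unfolding theta_log by (intro DERIV_mult)
  moreover have "K 0 = 1" using qpoch_q_nonzero[OF assms] by (simp add: K_def power2_eq_square)
  ultimately show ?thesis by (simp add: DERIV_imp_deriv)
qed

lemma thetaD_exp:
  assumes "norm q < 1"
  shows "thetaD q k (exp (z / 2)) = (deriv ^^ k) (theta_log q) z"
proof (induction k arbitrary: z)
  case (Suc k)
  have "(thetaD q k has_field_derivative deriv (thetaD q k) (exp (z / 2))) (at (exp (z / 2)))"
    using thetaD_holomorphic[OF assms, of k] by (intro holomorphic_derivI[of _ "- {0}"]) auto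
  then have "((\<lambda>z. thetaD q k (exp (z / 2))) has_field_derivative
      deriv (thetaD q k) (exp (z / 2)) * (exp (z / 2) * (1 / 2))) (at z)"
    by (rule DERIV_chain2) (auto intro!: derivative_eq_intros)
  then have "deriv (\<lambda>z. thetaD q k (exp (z / 2))) z = thetaD q (Suc k) (exp (z / 2))"
    by (simp add: DERIV_imp_deriv)
  then show ?case by (simp add: Suc.IH)
qed (simp add: theta_log_def)

lemma exp_eq_exp_imp: "exp z = exp w \<Longrightarrow> \<exists>l :: int. z = w + of_int l * (2 * pi * \<i>)"
  for z w :: complex
  using exp_eq[of z w] by (auto simp: algebra_simps)

locale nome =
  fixes q :: complex
  assumes q_nonzero: "q \<noteq> 0" and norm_q: "norm q < 1"

sublocale nome \<subseteq> theta_like "theta_log q" "Ln q" "- 1 / exp (Ln q / 2)"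
proof
  define r where "r = exp (Ln q / 2)"
  have r: "r \<noteq> 0" "r\<^sup>2 = q" using q_nonzero by (simp_all add: r_def flip: exp_double)
  show "theta_log q holomorphic_on UNIV" "deriv (theta_log q) 0 = 1"
    using norm_q by (fact theta_log_holomorphic deriv_theta_log_0)+
  show "theta_log q (- z) = - theta_log q z" for z
    using theta_inverse[of q "exp (z / 2)"] by (simp add: theta_log_def exp_minus field_simps)
  show "theta_log q (z + 2 * pi * \<i>) = - theta_log q z" for z
    using theta_minus[of q "exp (z / 2)"] by (simp add: theta_log_def add_divide_distrib exp_add)
  show "theta_log q (z + Ln q) = - 1 / exp (Ln q / 2) * exp (- z) * theta_log q z" for z
    using theta_mult_sqrt_nome[of r "exp (z / 2)"] norm_q
    by (simp add: theta_log_def r add_divide_distrib exp_add exp_minus inverse_eq_divide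
        flip: r_def exp_double)
  show "- 1 / exp (Ln q / 2) \<noteq> 0" by simp
  show "Re (Ln q) \<noteq> 0" using q_nonzero norm_q by simp
  show "\<exists>k l :: int. z = of_int k * Ln q + of_int l * (2 * pi * \<i>)" if zero: "theta_log q z = 0" for z
  proof -
    obtain k :: int where "(exp (z / 2))\<^sup>2 = q powi k"
      using theta_eq_0_imp[of q "exp (z / 2)"] q_nonzero norm_q zero by (auto simp: theta_log_def)
    also have "q powi k = exp (of_int k * Ln q)"
      using q_nonzero exp_power_int[of "Ln q" k] by simp
    finally have "exp z = exp (of_int k * Ln q)" by (simp flip: exp_double)
    then show ?thesis using exp_eq_exp_imp by blast
  qed
qed

definition log_coord :: "(nat \<Rightarrow> complex) \<Rightarrow> nat \<Rightarrow> complex" where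
  "log_coord s i = 2 * Ln (s i)"

lemma pprod_eq_exp:
  assumes "\<forall>i<n. s i \<noteq> 0" "\<sigma> permutes {..<n}" "m \<le> n"
  shows "pprod s \<sigma> m = exp ((\<Sum>x\<leftarrow>take m (map \<sigma> [0..<n]). log_coord s x) / 2)"
proof -
  have "pprod s \<sigma> m = (\<Prod>k<m. exp (log_coord s (\<sigma> k) / 2))"
    unfolding pprod_def log_coord_def using assms permutes_in_image[OF assms(2)]
    by (intro prod.cong) auto
  also have "\<dots> = exp ((\<Sum>k<m. log_coord s (\<sigma> k)) / 2)" by (simp add: exp_sum sum_divide_distrib)
  also have "(\<Sum>k<m. log_coord s (\<sigma> k)) = (\<Sum>x\<leftarrow>take m (map \<sigma> [0..<n]). log_coord s x)"
    using assms(3)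
    by (simp add: take_map take_upt sum_list_distinct_conv_sum_set o_def atLeast0LessThan)
  finally show ?thesis .
qed

lemma sum_log_coord_if_prod_squares_eq_1:
  assumes "\<forall>i<n. s i \<noteq> 0" "(\<Prod>i<n. (s i)\<^sup>2) = 1"
  obtains k :: int where "sum (log_coord s) {..<n} = of_int k * (2 * pi * \<i>)"
proof -
  have "exp (sum (log_coord s) {..<n}) = (\<Prod>i<n. (s i)\<^sup>2)"
    using assms(1) by (simp add: exp_sum log_coord_def exp_double)
  then show thesis using that exp_eq_exp_imp[of _ 0] assms(2) by auto
qed

context nome
begin

lemma theta_pprod:
  assumes "\<forall>i<n. s i \<noteq> 0" "\<sigma> permutes {..<n}" "m \<le> n"
  shows "theta q (pprod s \<sigma> m) = theta_log q (\<Sum>x\<leftarrow>take m (map \<sigma> [0..<n]). log_coord s x)"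
  by (simp add: theta_log_def pprod_eq_exp[OF assms])

lemma Tmat_eq_deriv_mat:
  assumes "\<forall>i<n. s i \<noteq> 0" "\<sigma> permutes {..<n}"
  shows "Tmat q n s \<sigma> = deriv_mat (log_coord s) (map \<sigma> [0..<n])"
  unfolding Tmat_def deriv_mat_def
  by (intro eq_matI) (auto simp: pprod_eq_exp[OF assms] thetaD_exp[OF norm_q])

lemma Tfun_eq_npoint_numer:
  assumes "1 \<le> n" and s: "\<forall>i<n. s i \<noteq> 0"
    and nz: "\<forall>\<sigma>. \<sigma> permutes {..<n} \<longrightarrow> (\<forall>m\<in>{1..<n}. theta q (pprod s \<sigma> m) \<noteq> 0)"
  shows "Tfun q n s = npoint_numer (log_coord s) {..<n}"
proof -
  let ?list = "\<lambda>\<sigma>. map \<sigma> [0..<n]"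
  have "Tfun q n s = (\<Sum>\<sigma> | \<sigma> permutes {..<n}. npoint_numer_term (log_coord s) (?list \<sigma>))"
    unfolding Tfun_def
  proof (intro sum.cong refl)
    fix \<sigma> assume "\<sigma> \<in> {\<sigma>. \<sigma> permutes {..<n}}"
    then have \<sigma>: "\<sigma> permutes {..<n}" by simp
    let ?denom = "\<Prod>m\<in>{1..<n}. theta q (pprod s \<sigma> m)"
    have "theta_log q (\<Sum>x\<leftarrow>take m (?list \<sigma>). log_coord s x) \<noteq> 0" if "1 \<le> m" "m < n" for m
      using nz \<sigma> that theta_pprod[OF s \<sigma>, of m] by auto
    then have "det (Tmat q n s \<sigma>) = npoint_numer_term (log_coord s) (?list \<sigma>)
        * (\<Prod>m\<in>{1..<n}. theta_log q (\<Sum>x\<leftarrow>take m (?list \<sigma>). log_coord s x))"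
      using det_deriv_mat[of "?list \<sigma>" "log_coord s"] assms(1)
      by (simp add: Tmat_eq_deriv_mat[OF s \<sigma>])
    also have "\<dots> = npoint_numer_term (log_coord s) (?list \<sigma>) * ?denom"
      by (simp add: theta_pprod[OF s \<sigma>])
    finally have "det (Tmat q n s \<sigma>) = npoint_numer_term (log_coord s) (?list \<sigma>) * ?denom" .
    moreover have "?denom \<noteq> 0" using nz \<sigma> by simp
    ultimately show "det (Tmat q n s \<sigma>) / ?denom = npoint_numer_term (log_coord s) (?list \<sigma>)"
      by simp
  qed
  also have "\<dots> = (\<Sum>xs\<in>permutations_of_set {..<n}. npoint_numer_term (log_coord s) xs)"
    by (rule sum.reindex_bij_betw[OF bij_betw_permutes_permutations_of_set])
  also have "\<dots> = npoint_numer (log_coord s) {..<n}"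
    by (simp add: npoint_numer_eq_sum_terms)
  finally show ?thesis .
qed

lemma regular_log_coord:
  assumes s: "\<forall>i<n. s i \<noteq> 0"
    and nz: "\<forall>\<sigma>. \<sigma> permutes {..<n} \<longrightarrow> (\<forall>m\<in>{1..<n}. theta q (pprod s \<sigma> m) \<noteq> 0)"
  shows "regular (log_coord s) {..<n}"
proof (rule regularI)
  fix B assume B: "B \<subset> {..<n}" "B \<noteq> {}"
  then have "finite B" "card B < n"
    using psubset_card_mono[of "{..<n}" B] by (auto intro: finite_subset)
  then have card: "card B \<in> {1..<n}" using B(2) by (simp add: Suc_le_eq card_gt_0_iff)
  obtain \<sigma> where \<sigma>: "\<sigma> permutes {..<n}" "take (card B) (map \<sigma> [0..<n]) \<in> permutations_of_set B"
    using B(1) by (blast intro: exists_permutes_prefix)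
  then have "theta_log q (sum (log_coord s) B) = theta q (pprod s \<sigma> (card B))"
    using card by (simp add: theta_pprod[OF s] sum_list_permutations_of_set)
  then show "theta_log q (sum (log_coord s) B) \<noteq> 0" using nz \<sigma>(1) card by metis
qed

end

theorem theorem11p2:
  fixes q :: complex and n :: nat and s :: "nat \<Rightarrow> complex"
  assumes "q \<noteq> 0" and "norm q < 1"
    and "n \<ge> 2"
    and "\<forall>i<n. s i \<noteq> 0"
    and "(\<Prod>i<n. (s i)\<^sup>2) = 1"
    and "\<forall>\<sigma>. \<sigma> permutes {..<n} \<longrightarrow> (\<forall>m\<in>{1..<n}. theta q (pprod s \<sigma> m) \<noteq> 0)"
  shows "Tfun q n s = 0"
proof -
  interpret nome q using assms(1,2) by unfold_locales
  obtain k :: int where "sum (log_coord s) {..<n} = of_int k * (2 * pi * \<i>)"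
    using assms(4,5) by (rule sum_log_coord_if_prod_squares_eq_1)
  moreover have "regular (log_coord s) {..<n}"
    using assms(4,6) by (rule regular_log_coord)
  moreover have "Tfun q n s = npoint_numer (log_coord s) {..<n}"
    using assms(3,4,6) by (intro Tfun_eq_npoint_numer) auto
  ultimately show ?thesis
    using assms(3) npoint_numer_eq_0[of "{..<n}" "log_coord s" k] by simp
qed

end
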